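(* Let $g$ be a non-negative real-valued multiplicative function that is uniformly bounded on the primes. Assume that there is a positive constant $c$ such that for each $b$ with $0<b<1$, \[ \liminf_{x\to\infty} \big((1-b)\log x\big)^{-1} \sum_{x^b<p\le x} p^{-1} g(p)\log p \ \ge\ c, \] the sum being over primes. Then there is a positive constant $c_0$ such that for all $x\ge 2$, \[ \sum_{n\le x} g(n) \ \ge\ \frac{c_0 x}{\log x}\prod_{p\le x}\left(1+\frac{g(p)}{p}\right). \]
   Context: Multiplicative means $f(mn)=f(m)f(n)$ whenever $\gcd(m,n)=1$, with $f(1)=1$. Sums and products indexed by $p$ run over primes. *)

theory Defs
  imports "HOL-Analysis.Analysis" "HOL-Computational_Algebra.Primes"
begin

definition multiplicative_fun :: "(nat \<Rightarrow> real) \<Rightarrow> bool" where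
  "multiplicative_fun f \<longleftrightarrow> f 1 = 1 \<and> (\<forall>m n. coprime m n \<longrightarrow> f (m * n) = f m * f n)"

end

theory Submission
  imports Defs
begin

text \<open>
  On a logarithmic scale (base 2) the hypothesis says that the set \<open>A\<close> of exponents \<open>n\<close> for which the
  primes in \<open>(2^n, 2^(n+1)]\<close> carry a fair share of \<open>g\<close> has density at least some \<open>\<beta> > 0\<close> in every
  interval \<open>[s, t)\<close> with \<open>t - s\<close> at least a small multiple of \<open>t\<close>. On shorter scales \<open>A\<close> may have gaps,
  so that sums of \<open>g\<close> over primes need not be large everywhere. Sums of boundedly many elements of \<open>A\<close>
  do fill an interval: in a version of Schnirelmann's theorem for popular sums, the complement
  shrinks by a constant factor with every summand. Hence, with \<open>L = log x\<close>, for every \<open>y\<close> in a range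
  \<open>[x^(1 - \<delta>), x]\<close> the sum of \<open>g(p\<^sub>1 \<dots> p\<^sub>K)\<close> over suitable products \<open>p\<^sub>1 \<dots> p\<^sub>K \<le> y\<close> of large primes is
  at least a constant times \<open>y / L\<close>. Taking \<open>y = x / m\<close> and summing over \<open>m \<le> x^\<delta>\<close> gives a constant
  times \<open>x / L\<close> times the sum of \<open>g(m) / m\<close>, and the latter is comparable to the Euler product because
  \<open>g\<close> is bounded on the primes.
\<close>

section \<open>Robust growth of sumsets\<close>

text \<open>The threshold beyond which the liminf bound holds depends on b, so b has to be fixed
  before x. Density is then known only on intervals of length at least w, about \<epsilon> N, with N
  comparable to log x, and every growth step makes an additive error of order w. This forces
  boundedly many steps: the density \<beta> of A depends only on c and the bound for g at primes,
  \<beta> determines the number k of steps, and only then \<epsilon> and b = 1 - \<eta> are chosen.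

  A bare sumset would not be enough. A block in A has mass of order 2^a / N, so a single
  representation n = a + (n - a) would lose a factor N with each new prime. Asking for at least
  \<kappa> N representations restores that factor, and k + 2 primes still cost a single 1 / N.
  Popularity in turn obstructs Schnirelmann's argument, in which every sum counts: one starting
  point in A must serve nearly all points of E at once. A maximal inequality and averaging over
  starting points provide it.\<close>

lemma card_Int_atLeastLessThan_split:
  fixes a b c :: nat
  assumes "a \<le> b" "b \<le> c"
  shows "card (A \<inter> {a..<c}) = card (A \<inter> {a..<b}) + card (A \<inter> {b..<c})"
proof -
  have "A \<inter> {a..<c} = (A \<inter> {a..<b}) \<union> (A \<inter> {b..<c})"
    using assms by auto
  then show ?thesis
    by (simp add: card_Un_disjoint disjoint_iff)
qed

text \<open>Schnirelmann density tests all initial segments from one point. A leader is a point that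
  may play that role, with lengths capped at \<open>N\<close> because density is known in a bounded
  range only.\<close>

definition leaders :: "nat set \<Rightarrow> real \<Rightarrow> nat \<Rightarrow> nat set" where
  "leaders A \<delta> N = {a. \<forall>X\<in>{1..N}. \<delta> * real X \<le> real (card (A \<inter> {a..<a + X}))}"

text \<open>This lemma and \<open>card_crowded_le\<close> are greedy covering arguments in the manner of the rising sun lemma.\<close>

lemma card_leaders_ge:
  fixes A :: "nat set" and \<beta> :: real
  assumes \<beta>: "\<beta> \<ge> 0"
    and dens: "\<And>t. s + w \<le> t \<Longrightarrow> t \<le> s + w + N \<Longrightarrow> \<beta> * (real t - real s) \<le> real (card (A \<inter> {s..<t}))"
  shows "\<beta> / 2 * real w \<le> real (card (leaders A (\<beta> / 2) N \<inter> {s..<s + w}))"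
proof -
  define L where "L = leaders A (\<beta> / 2) N"
  \<comment> \<open>Walk to the right from \<open>a\<close>: a leader is passed by one place and
    counted, elsewhere the walk jumps over a window in which \<open>A\<close> has density below
    \<open>\<beta> / 2\<close>. The last jump may overshoot \<open>s + w\<close> by up to
    \<open>N\<close>, hence the range of \<open>t\<close>.\<close>
  have claim: "\<exists>t. s + w \<le> t \<and> t \<le> s + w + N \<and>
      real (card (A \<inter> {a..<t})) \<le> real (card (L \<inter> {a..<s + w})) + \<beta> / 2 * (real t - real a)"
    if "a \<le> s + w" for a
    using that
  proof (induction "s + w - a" arbitrary: a rule: less_induct)
    case less
    show ?case
    proof (cases "a = s + w")
      case True
      then show ?thesis by (intro exI[of _ a]) auto
    next
      case False
      then have a: "a < s + w" using less.prems by simp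
      show ?thesis
      proof (cases "a \<in> L")
        case True
        obtain t where t: "s + w \<le> t" "t \<le> s + w + N"
          "real (card (A \<inter> {Suc a..<t})) \<le> real (card (L \<inter> {Suc a..<s + w})) + \<beta> / 2 * (real t - real (Suc a))"
          using less.hyps[OF diff_less_mono2[OF lessI a]] a by auto
        have "card (L \<inter> {a..<s + w}) = card (L \<inter> {a..<Suc a}) + card (L \<inter> {Suc a..<s + w})"
          using a by (intro card_Int_atLeastLessThan_split) auto
        moreover have "L \<inter> {a..<Suc a} = {a}" using True by auto
        ultimately have 1: "card (L \<inter> {a..<s + w}) = 1 + card (L \<inter> {Suc a..<s + w})" by simp
        have "card (A \<inter> {a..<t}) = card (A \<inter> {a..<Suc a}) + card (A \<inter> {Suc a..<t})"
          using a t by (intro card_Int_atLeastLessThan_split) auto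
        moreover have "card (A \<inter> {a..<Suc a}) \<le> card {a}" by (intro card_mono) auto
        ultimately have 2: "card (A \<inter> {a..<t}) \<le> 1 + card (A \<inter> {Suc a..<t})" by simp
        have "\<beta> / 2 * (real t - real (Suc a)) \<le> \<beta> / 2 * (real t - real a)"
          using \<beta> by (intro mult_left_mono) auto
        then show ?thesis using 1 2 t by (intro exI[of _ t]) auto
      next
        case False
        then obtain X where X: "1 \<le> X" "X \<le> N"
          "real (card (A \<inter> {a..<a + X})) < \<beta> / 2 * real X"
          by (auto simp: L_def leaders_def not_le)
        show ?thesis
        proof (cases "a + X \<ge> s + w")
          case True
          then show ?thesis using X a by (intro exI[of _ "a + X"]) auto
        next
          case False
          have lt: "s + w - (a + X) < s + w - a" using a X by simp
          obtain t where t: "s + w \<le> t" "t \<le> s + w + N"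
            "real (card (A \<inter> {a + X..<t})) \<le> real (card (L \<inter> {a + X..<s + w})) + \<beta> / 2 * (real t - real (a + X))"
            using less.hyps[OF lt] False by auto
          have "card (A \<inter> {a..<t}) = card (A \<inter> {a..<a + X}) + card (A \<inter> {a + X..<t})"
            using a t False by (intro card_Int_atLeastLessThan_split) auto
          moreover have "card (L \<inter> {a + X..<s + w}) \<le> card (L \<inter> {a..<s + w})"
            by (intro card_mono) auto
          ultimately have "real (card (A \<inter> {a..<t})) \<le> real (card (L \<inter> {a..<s + w})) +
              (\<beta> / 2 * real X + \<beta> / 2 * (real t - real (a + X)))"
            using t X by linarith
          also have "\<beta> / 2 * real X + \<beta> / 2 * (real t - real (a + X)) = \<beta> / 2 * (real t - real a)"
            by (simp add: field_simps)
          finally show ?thesis using t by (intro exI[of _ t]) auto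
        qed
      qed
    qed
  qed
  obtain t where t: "s + w \<le> t" "t \<le> s + w + N"
    "real (card (A \<inter> {s..<t})) \<le> real (card (L \<inter> {s..<s + w})) + \<beta> / 2 * (real t - real s)"
    using claim[of s] by auto
  have "\<beta> / 2 * real w \<le> \<beta> / 2 * (real t - real s)"
    using \<beta> t by (intro mult_left_mono) auto
  also have "\<dots> \<le> real (card (L \<inter> {s..<s + w}))"
    using dens[of t] t by (simp add: field_simps)
  finally show ?thesis by (simp add: L_def)
qed

text \<open>The superlevel set of the one-sided discrete maximal function of the indicator of
  \<open>B\<close>; \<open>card_crowded_le\<close> is its weak-type inequality with constant
  1.\<close>

definition crowded :: "nat set \<Rightarrow> real \<Rightarrow> nat set" where
  "crowded B \<gamma> = {a. \<exists>X\<ge>1. \<gamma> * real X < real (card (B \<inter> {a..<a + X}))}"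

lemma card_crowded_le:
  assumes \<gamma>: "\<gamma> \<ge> 0" and fin: "finite B"
  shows "\<gamma> * real (card (crowded B \<gamma> \<inter> {s..<u})) \<le> real (card B)"
proof -
  define Bad where "Bad = crowded B \<gamma> \<inter> {s..<u}"
  have finBad: "finite Bad" by (simp add: Bad_def)
  \<comment> \<open>Stated for tails because a window that starts before \<open>u\<close> may end
    beyond it.\<close>
  have claim: "\<gamma> * real (card (Bad \<inter> {a..})) \<le> real (card (B \<inter> {a..}))" for a
  proof (induction "u - a" arbitrary: a rule: less_induct)
    case less
    show ?case
    proof (cases "a < u")
      case False
      then have "Bad \<inter> {a..} = {}" by (auto simp: Bad_def)
      then show ?thesis by simp
    next
      case a: True
      have split: "card (C \<inter> {a..}) = card (C \<inter> {a..<a + X}) + card (C \<inter> {a + X..})"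
        if "finite C" for C :: "nat set" and X
      proof -
        have "C \<inter> {a..} = (C \<inter> {a..<a + X}) \<union> (C \<inter> {a + X..})" by auto
        then show ?thesis using that by (simp add: card_Un_disjoint disjoint_iff)
      qed
      show ?thesis
      proof (cases "a \<in> Bad")
        case False
        have IH: "\<gamma> * real (card (Bad \<inter> {a + 1..})) \<le> real (card (B \<inter> {a + 1..}))"
          using a by (intro less.hyps) auto
        have "Bad \<inter> {a..<a + 1} = {}" using False by auto
        then show ?thesis using IH split[OF finBad, of 1] split[OF fin, of 1] by simp
      next
        case True
        then obtain X where X: "X \<ge> 1" "\<gamma> * real X < real (card (B \<inter> {a..<a + X}))"
          by (auto simp: Bad_def crowded_def)
        have IH: "\<gamma> * real (card (Bad \<inter> {a + X..})) \<le> real (card (B \<inter> {a + X..}))"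
          using a X by (intro less.hyps) auto
        have "card (Bad \<inter> {a..<a + X}) \<le> card {a..<a + X}" by (intro card_mono) auto
        then have "\<gamma> * real (card (Bad \<inter> {a..<a + X})) \<le> \<gamma> * real X"
          using \<gamma> by (intro mult_left_mono) auto
        then show ?thesis
          using IH X split[OF finBad, of X] split[OF fin, of X] by (simp add: algebra_simps)
      qed
    qed
  qed
  from claim[of 0] show ?thesis by (simp add: Bad_def)
qed

text \<open>Cut \<open>{v..<M}\<close> at the points of \<open>E\<close>. A piece of length
  \<open>X\<close> has \<open>X - 1\<close> points outside \<open>E\<close>; the summand 1 in
  \<open>fill\<close> pays for its left end point, so the translated piece misses at most
  \<open>(1 - \<gamma>) * (X - 1)\<close> points of \<open>F\<close>. Nothing is lost for
  \<open>X = 1\<close>, which is why the factor applies to the complement alone.\<close>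

lemma gap_filling:
  fixes E F :: "nat set" and \<gamma> :: real
  assumes fill: "\<And>v X. v \<in> E \<Longrightarrow> 1 \<le> X \<Longrightarrow> v + X \<le> M \<Longrightarrow>
      1 + \<gamma> * (real X - 1) \<le> real (card (F \<inter> {v + a..<v + a + X}))"
    and v: "v \<in> E" "v < M"
  shows "real (card ({v + a..<M + a} - F)) \<le> (1 - \<gamma>) * real (card ({v..<M} - E))"
  using v
proof (induction "M - v" arbitrary: v rule: less_induct)
  case less
  \<comment> \<open>The next point of \<open>E\<close>; the default \<open>M\<close> closes the last
    piece.\<close>
  define v' where "v' = (if \<exists>u\<in>E. v < u \<and> u < M then LEAST u. u \<in> E \<and> v < u \<and> u < M else M)"
  have v': "v < v'" "v' \<le> M" "\<And>u. v < u \<Longrightarrow> u < v' \<Longrightarrow> u \<notin> E" "v' \<in> E \<or> v' = M"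
  proof -
    have "v < v' \<and> v' \<le> M \<and> (\<forall>u. v < u \<longrightarrow> u < v' \<longrightarrow> u \<notin> E) \<and> (v' \<in> E \<or> v' = M)"
    proof (cases "\<exists>u\<in>E. v < u \<and> u < M")
      case True
      then have *: "v' = (LEAST u. u \<in> E \<and> v < u \<and> u < M)" by (simp add: v'_def)
      have "v' \<in> E \<and> v < v' \<and> v' < M"
        unfolding * by (rule LeastI_ex) (use True in auto)
      moreover have "u \<notin> E" if "v < u" "u < v'" for u
      proof
        assume "u \<in> E"
        then have "v' \<le> u" unfolding * using that calculation by (intro Least_le) auto
        then show False using that by simp
      qed
      ultimately show ?thesis by auto
    next
      case False
      then have "v' = M" by (auto simp: v'_def)
      with False less.prems show ?thesis by auto
    qed
    then show "v < v'" "v' \<le> M" "\<And>u. v < u \<Longrightarrow> u < v' \<Longrightarrow> u \<notin> E" "v' \<in> E \<or> v' = M"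
      by blast+
  qed
  define X where "X = v' - v"
  have X: "X \<ge> 1" "v' = v + X" using v' by (auto simp: X_def)
  have rest: "real (card ({v' + a..<M + a} - F)) \<le> (1 - \<gamma>) * real (card ({v'..<M} - E))"
  proof (cases "v' < M")
    case True
    then show ?thesis using v' less.hyps[of v'] by auto
  next
    case False
    then show ?thesis using v' by simp
  qed
  have "{v..<M} - E = ({v<..<v'} \<union> ({v'..<M} - E))"
    using v' less.prems by (auto simp: not_less)
  then have 1: "card ({v..<M} - E) = (X - 1) + card ({v'..<M} - E)"
    using v' by (simp add: card_Un_disjoint disjoint_iff X_def)
  have "{v + a..<M + a} - F = ({v + a..<v + a + X} - F) \<union> ({v' + a..<M + a} - F)"
    using v' X by auto
  then have "card ({v + a..<M + a} - F) \<le> card ({v + a..<v + a + X} - F) + card ({v' + a..<M + a} - F)"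
    by (metis card_Un_le)
  moreover have "real (card ({v + a..<v + a + X} - F)) = real X - real (card (F \<inter> {v + a..<v + a + X}))"
  proof -
    have "card ({v + a..<v + a + X} - F) = X - card (F \<inter> {v + a..<v + a + X})"
      by (simp add: card_Diff_subset_Int Int_commute)
    moreover have "card (F \<inter> {v + a..<v + a + X}) \<le> card {v + a..<v + a + X}"
      by (intro card_mono) auto
    ultimately show ?thesis by simp
  qed
  moreover have "1 + \<gamma> * (real X - 1) \<le> real (card (F \<inter> {v + a..<v + a + X}))"
    using X v' less.prems by (intro fill) auto
  ultimately have "real (card ({v + a..<M + a} - F)) \<le> (1 - \<gamma>) * (real X - 1) + (1 - \<gamma>) * real (card ({v'..<M} - E))"
    using rest by (simp add: algebra_simps)
  also have "\<dots> = (1 - \<gamma>) * real (card ({v..<M} - E))"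
    using X by (simp add: 1 algebra_simps)
  finally show ?case .
qed

section \<open>Popular sums and one step of growth\<close>

definition popular_sums :: "nat set \<Rightarrow> nat set \<Rightarrow> real \<Rightarrow> nat set" where
  "popular_sums E A \<kappa> = {n. \<kappa> \<le> real (card {a\<in>A. a \<le> n \<and> n - a \<in> E})}"

text \<open>Without thickening no growth is possible: if \<open>E\<close> and \<open>A\<close> consist of the multiples of 10,
  then so does their sumset. Thickening is harmless later on, since summatory functions of
  nonnegative functions are monotone.\<close>

definition thicken :: "nat set \<Rightarrow> nat set" where
  "thicken P = Suc ` P \<union> (Suc \<circ> Suc) ` P"

text \<open>Double counting of pairs: all sums lie in an interval of length \<open>3 * N\<close>,
  and an unpopular one has fewer than \<open>\<kappa>\<close> representations.\<close>

lemma sum_card_unpopular_le: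
  fixes E A :: "nat set"
  assumes E: "E \<subseteq> {e..<e + N}" and A: "A \<subseteq> {s..<s + 2 * N}" and \<kappa>: "\<kappa> \<ge> 0"
  shows "(\<Sum>v\<in>E. real (card {a\<in>A. v + a \<notin> popular_sums E A \<kappa>})) \<le> 3 * real N * \<kappa>"
proof -
  define P where "P = popular_sums E A \<kappa>"
  have finE: "finite E" and finA: "finite A" using E A finite_subset by blast+
  define I where "I = {e + s..<e + s + 3 * N}"
  have "(\<Sum>v\<in>E. card {a\<in>A. v + a \<notin> P}) = card (SIGMA v:E. {a\<in>A. v + a \<notin> P})"
    using finE finA by simp
  also have "\<dots> \<le> card (SIGMA n:I - P. {a\<in>A. a \<le> n \<and> n - a \<in> E})"
  proof (rule card_inj_on_le[where f = "\<lambda>(v, a). (v + a, a)"])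
    show "inj_on (\<lambda>(v, a). (v + a, a)) (SIGMA v:E. {a\<in>A. v + a \<notin> P})"
      by (auto simp: inj_on_def)
    show "(\<lambda>(v, a). (v + a, a)) ` (SIGMA v:E. {a\<in>A. v + a \<notin> P})
        \<subseteq> (SIGMA n:I - P. {a\<in>A. a \<le> n \<and> n - a \<in> E})"
    proof -
      have "v + a \<in> I" if "v \<in> E" "a \<in> A" for v a
        using subsetD[OF E that(1)] subsetD[OF A that(2)] by (auto simp: I_def)
      then show ?thesis by auto
    qed
    show "finite (SIGMA n:I - P. {a\<in>A. a \<le> n \<and> n - a \<in> E})"
      using finA by (intro finite_SigmaI) (auto simp: I_def)
  qed
  also have "\<dots> = (\<Sum>n\<in>I - P. card {a\<in>A. a \<le> n \<and> n - a \<in> E})"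
    using finA by (subst card_SigmaI) (auto simp: I_def)
  finally have "(\<Sum>v\<in>E. real (card {a\<in>A. v + a \<notin> P})) \<le>
      (\<Sum>n\<in>I - P. real (card {a\<in>A. a \<le> n \<and> n - a \<in> E}))"
    unfolding of_nat_sum[symmetric] by (simp only: of_nat_le_iff)
  also have "\<dots> \<le> (\<Sum>n\<in>I - P. \<kappa>)"
    by (intro sum_mono) (auto simp: P_def popular_sums_def)
  also have "\<dots> = real (card (I - P)) * \<kappa>" by simp
  also have "\<dots> \<le> real (card I) * \<kappa>"
    using \<kappa> card_mono[of I "I - P"] by (intro mult_right_mono) (auto simp: I_def)
  finally show ?thesis by (simp add: P_def I_def)
qed

text \<open>All gaps of \<open>E\<close> are compared with their translates by one and the same
  \<open>a\<close>, so \<open>a\<close> must not depend on \<open>v\<close>. There are at least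
  \<open>\<beta> * w / 2\<close> leaders in \<open>{s..<s + w}\<close>. By the maximal inequality,
  at most \<open>12 * N * \<kappa> / \<beta>\<close> pairs of a leader \<open>a\<close> and a point
  \<open>v\<close> are such that unpopular sums crowd \<open>a\<close>. By \<open>small\<close>,
  some leader is bad for at most \<open>\<tau>\<close> of the \<open>v\<close>.\<close>

lemma obtain_common_leader:
  fixes E A :: "nat set" and \<beta> \<tau> \<kappa> :: real
  assumes \<beta>: "0 < \<beta>" and w: "1 \<le> w" and N: "0 < N" and \<kappa>: "0 \<le> \<kappa>" and \<tau>: "0 \<le> \<tau>"
    and E: "E \<subseteq> {e..<e + N}" and A: "A \<subseteq> {s..<s + 2 * N}"
    and dens: "\<And>t. s + w \<le> t \<Longrightarrow> t \<le> s + w + N \<Longrightarrow> \<beta> * (real t - real s) \<le> real (card (A \<inter> {s..<t}))"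
    and small: "24 * \<kappa> * real N \<le> \<beta>\<^sup>2 * \<tau> * real w"
  obtains a V where "s \<le> a" "a < s + w" "V \<subseteq> E" "real (card V) \<le> \<tau>"
    "\<And>v X. v \<in> E - V \<Longrightarrow> 1 \<le> X \<Longrightarrow> X \<le> N \<Longrightarrow>
      \<beta> / 4 * real X \<le> real (card {u\<in>A \<inter> {a..<a + X}. v + u \<in> popular_sums E A \<kappa>})"
proof -
  define P where "P = popular_sums E A \<kappa>"
  define B where "B = (\<lambda>v. {a\<in>A. v + a \<notin> P})"
  define L where "L = leaders A (\<beta> / 2) N \<inter> {s..<s + w}"
  define Bad where "Bad = (\<lambda>v. crowded (B v) (\<beta> / 4) \<inter> {s..<s + w})"
  have finE: "finite E" and finA: "finite A" using E A finite_subset by blast+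
  have finL: "finite L" by (simp add: L_def)
  have finBad: "finite (Bad v)" for v by (simp add: Bad_def)
  have L: "\<beta> / 2 * real w \<le> real (card L)"
    unfolding L_def using \<beta> dens by (intro card_leaders_ge) auto
  have Lne: "L \<noteq> {}"
  proof
    assume "L = {}"
    then show False using L \<beta> w by (simp add: field_simps mult_le_0_iff)
  qed
  have "\<exists>a\<in>L. real (card {v\<in>E. a \<in> Bad v}) \<le> \<tau>"
  proof (rule ccontr)
    assume neg: "\<not> ?thesis"
    have "\<beta> / 2 * real w * \<tau> \<le> real (card L) * \<tau>"
      using L \<tau> by (intro mult_right_mono) auto
    also have "\<dots> = (\<Sum>a\<in>L. \<tau>)" by simp
    also have "\<dots> < (\<Sum>a\<in>L. real (card {v\<in>E. a \<in> Bad v}))"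
      using neg finL Lne by (intro sum_strict_mono) auto
    also have "\<dots> = real (\<Sum>a\<in>L. card {v\<in>E. a \<in> Bad v})" by simp
    also have "(\<Sum>a\<in>L. card {v\<in>E. a \<in> Bad v}) = (\<Sum>v\<in>E. card {a\<in>L. a \<in> Bad v})"
      using sum_multicount_gen[OF finL finE, of "\<lambda>a v. a \<in> Bad v" "\<lambda>v. card {a\<in>L. a \<in> Bad v}"]
      by simp
    also have "real \<dots> \<le> (\<Sum>v\<in>E. real (card (Bad v)))"
      unfolding of_nat_sum by (intro sum_mono of_nat_mono card_mono finBad) auto
    also have "\<dots> \<le> (\<Sum>v\<in>E. 4 / \<beta> * real (card (B v)))"
    proof (intro sum_mono)
      fix v assume "v \<in> E"
      have "\<beta> / 4 * real (card (Bad v)) \<le> real (card (B v))"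
        unfolding Bad_def using \<beta> finA by (intro card_crowded_le) (auto simp: B_def)
      then show "real (card (Bad v)) \<le> 4 / \<beta> * real (card (B v))"
        using \<beta> by (simp add: field_simps)
    qed
    also have "\<dots> = 4 / \<beta> * (\<Sum>v\<in>E. real (card (B v)))" by (simp add: sum_distrib_left)
    also have "\<dots> \<le> 4 / \<beta> * (3 * real N * \<kappa>)"
      unfolding B_def P_def using \<beta> E A \<kappa> by (intro mult_left_mono sum_card_unpopular_le) auto
    finally have "\<beta>\<^sup>2 * \<tau> * real w < 24 * \<kappa> * real N"
      using \<beta> by (simp add: field_simps power2_eq_square)
    then show False using small by simp
  qed
  then obtain a where a: "a \<in> L" "real (card {v\<in>E. a \<in> Bad v}) \<le> \<tau>" by auto
  show ?thesis
  proof (rule that[of a "{v\<in>E. a \<in> Bad v}"])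
    show "s \<le> a" "a < s + w" using a by (auto simp: L_def)
    fix v X assume v: "v \<in> E - {v\<in>E. a \<in> Bad v}" and X: "1 \<le> X" "X \<le> N"
    \<comment> \<open>Density \<open>\<beta> / 2\<close> from the leader, minus at most
      \<open>\<beta> / 4\<close> taken by unpopular sums, leaves \<open>\<beta> / 4\<close>.\<close>
    have 1: "\<beta> / 2 * real X \<le> real (card (A \<inter> {a..<a + X}))"
      using a X by (auto simp: L_def leaders_def)
    have "a \<notin> Bad v" using v by auto
    then have 2: "real (card (B v \<inter> {a..<a + X})) \<le> \<beta> / 4 * real X"
      using a X by (auto simp: Bad_def crowded_def L_def not_less)
    have "A \<inter> {a..<a + X} = {u\<in>A \<inter> {a..<a + X}. v + u \<in> P} \<union> (B v \<inter> {a..<a + X})"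
      by (auto simp: B_def)
    then have "card (A \<inter> {a..<a + X}) \<le> card {u\<in>A \<inter> {a..<a + X}. v + u \<in> P} + card (B v \<inter> {a..<a + X})"
      by (metis card_Un_le)
    then show "\<beta> / 4 * real X \<le> real (card {u\<in>A \<inter> {a..<a + X}. v + u \<in> popular_sums E A \<kappa>})"
      using 1 2 by (simp add: P_def)
  qed (use a in auto)
qed

text \<open>Schnirelmann's argument: seen from a leader \<open>a\<close> of \<open>A\<close>, every gap of \<open>E\<close> is filled in
  proportion \<open>\<beta> / 8\<close> by the translates of \<open>A\<close> attached to its left end point. The set \<open>V\<close> of
  discarded end points and the initial segment of length \<open>w\<close> account for the error terms.\<close>

lemma popular_step:
  fixes E A :: "nat set" and \<beta> \<tau> \<kappa> :: real
  assumes \<beta>: "0 < \<beta>" "\<beta> \<le> 1" and w: "1 \<le> w" "w \<le> N" and \<kappa>: "0 \<le> \<kappa>" and \<tau>: "0 \<le> \<tau>"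
    and E: "E \<subseteq> {e..<e + N}" and A: "A \<subseteq> {s..<s + 2 * N}"
    and dens: "\<And>t. s + w \<le> t \<Longrightarrow> t \<le> s + w + N \<Longrightarrow> \<beta> * (real t - real s) \<le> real (card (A \<inter> {s..<t}))"
    and small: "24 * \<kappa> * real N \<le> \<beta>\<^sup>2 * \<tau> * real w"
    and hit: "\<tau> < real (card (E \<inter> {e..<e + w}))"
  obtains e' where "e + s + 1 \<le> e'" "e' < e + s + w + 1"
    "real (card ({e'..<e' + N} - thicken (popular_sums E A \<kappa>)))
      \<le> (1 - \<beta> / 8) * real (card ({e..<e + N} - E)) + \<tau> + real w"
    "real (card (E \<inter> {e..<e + w})) - \<tau> \<le> real (card (thicken (popular_sums E A \<kappa>) \<inter> {e'..<e' + w}))"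
proof -
  define P where "P = popular_sums E A \<kappa>"
  define F where "F = thicken P"
  have N: "N > 0" using w by simp
  have finE: "finite E" using E finite_subset by blast
  obtain a V where a: "s \<le> a" "a < s + w" and V: "V \<subseteq> E" "real (card V) \<le> \<tau>"
    and lead: "\<And>v X. v \<in> E - V \<Longrightarrow> 1 \<le> X \<Longrightarrow> X \<le> N \<Longrightarrow>
      \<beta> / 4 * real X \<le> real (card {u\<in>A \<inter> {a..<a + X}. v + u \<in> P})"
    by (rule obtain_common_leader[OF \<beta>(1) w(1) N \<kappa> \<tau> E A dens small, folded P_def]) (assumption, assumption, (rule that; assumption))
  have finV: "finite V" using V finE finite_subset by blast
  define E1 where "E1 = E - V"
  have inP: "v + a \<in> P" if "v \<in> E1" for v
  proof -
    have "0 < real (card {u\<in>A \<inter> {a..<a + 1}. v + u \<in> P})"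
      using lead[of v 1] that N \<beta> by (simp add: E1_def)
    then have "{u\<in>A \<inter> {a..<a + 1}. v + u \<in> P} \<noteq> {}"
      by (metis card.empty of_nat_0 less_irrefl)
    then show ?thesis by auto
  qed
  have fill: "1 + \<beta> / 8 * (real X - 1) \<le> real (card (F \<inter> {v + (a + 1)..<v + (a + 1) + X}))"
    if v: "v \<in> E1" and X: "1 \<le> X" "v + X \<le> e + N" for v X
  proof -
    define J where "J = {v + (a + 1)..<v + (a + 1) + X}"
    have XN: "X \<le> N" using v X E by (auto simp: E1_def)
    have one: "Suc (v + a) \<in> F" "Suc (Suc (v + a)) \<in> F"
      using inP[OF v] by (auto simp: F_def thicken_def)
    have "card {u\<in>A \<inter> {a..<a + X}. v + u \<in> P} \<le> card (F \<inter> J)"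
    proof (rule card_inj_on_le[where f = "\<lambda>u. Suc (v + u)"])
      show "inj_on (\<lambda>u. Suc (v + u)) {u\<in>A \<inter> {a..<a + X}. v + u \<in> P}"
        by (auto simp: inj_on_def)
      show "(\<lambda>u. Suc (v + u)) ` {u\<in>A \<inter> {a..<a + X}. v + u \<in> P} \<subseteq> F \<inter> J"
        by (auto simp: F_def thicken_def J_def)
    qed (simp add: J_def)
    then have many: "\<beta> / 4 * real X \<le> real (card (F \<inter> J))"
      using lead[of v X] v X XN by (fastforce simp: E1_def)
    \<comment> \<open>Half of \<open>\<beta> / 4\<close> is given up for the summand 1 that
      \<open>gap_filling\<close> demands. Beyond length \<open>8 / \<beta>\<close> that half pays
      for it; shorter gaps use the points \<open>v + a + 1\<close> and \<open>v + a + 2\<close>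
      supplied by thickening, only the first of them if \<open>X = 1\<close>.\<close>
    consider "X = 1" | "2 \<le> X" "real X \<le> 8 / \<beta>" | "real X > 8 / \<beta>" using X by linarith
    then show ?thesis
    proof cases
      case 1
      have "card {Suc (v + a)} \<le> card (F \<inter> J)"
        using one 1 by (intro card_mono) (auto simp: J_def)
      then show ?thesis using 1 by (simp add: J_def)
    next
      case 2
      have "card {Suc (v + a), Suc (Suc (v + a))} \<le> card (F \<inter> J)"
        using one 2 by (intro card_mono) (auto simp: J_def)
      moreover have "\<beta> / 8 * (real X - 1) \<le> 1"
        using 2 \<beta> by (simp add: field_simps)
      ultimately show ?thesis by (simp add: J_def)
    next
      case 3
      then have "1 \<le> \<beta> / 8 * real X" using \<beta> by (simp add: field_simps)
      then have "1 + \<beta> / 8 * (real X - 1) \<le> \<beta> / 4 * real X"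
        using \<beta> by (simp add: right_diff_distrib)
      then show ?thesis using many by (simp add: J_def)
    qed
  qed
  have cardE1: "real (card (E \<inter> S)) - \<tau> \<le> real (card (E1 \<inter> S))" for S
  proof -
    have "E \<inter> S \<subseteq> (E1 \<inter> S) \<union> V" by (auto simp: E1_def)
    then have "card (E \<inter> S) \<le> card ((E1 \<inter> S) \<union> V)"
      using finE finV by (intro card_mono) (auto simp: E1_def)
    also have "\<dots> \<le> card (E1 \<inter> S) + card V" by (rule card_Un_le)
    finally show ?thesis using V by simp
  qed
  \<comment> \<open>Gap filling has to start at a surviving point. One exists among the first
    \<open>w\<close> places, and the places before it make up the error \<open>w\<close>.\<close>
  have "0 < real (card (E1 \<inter> {e..<e + w}))" using cardE1[of "{e..<e + w}"] hit by linarith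
  then have "E1 \<inter> {e..<e + w} \<noteq> {}" by (metis card.empty of_nat_0 less_irrefl)
  then obtain v0 where v0: "v0 \<in> E1" "e \<le> v0" "v0 < e + w" by auto
  have "real (card ({v0 + (a + 1)..<e + N + (a + 1)} - F)) \<le> (1 - \<beta> / 8) * real (card ({v0..<e + N} - E1))"
    using fill v0 w by (intro gap_filling) auto
  also have "real (card ({v0..<e + N} - E1)) \<le> real (card ({e..<e + N} - E)) + \<tau>"
  proof -
    have "{v0..<e + N} - E1 \<subseteq> ({e..<e + N} - E) \<union> V" using v0 by (auto simp: E1_def)
    then have "card ({v0..<e + N} - E1) \<le> card (({e..<e + N} - E) \<union> V)"
      using finV by (intro card_mono) auto
    also have "\<dots> \<le> card ({e..<e + N} - E) + card V" by (rule card_Un_le)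
    finally show ?thesis using V by simp
  qed
  also have "(1 - \<beta> / 8) * (real (card ({e..<e + N} - E)) + \<tau>) \<le>
      (1 - \<beta> / 8) * real (card ({e..<e + N} - E)) + \<tau>"
    using \<beta> \<tau> by (simp add: algebra_simps)
  finally have main: "real (card ({v0 + (a + 1)..<e + N + (a + 1)} - F)) \<le>
      (1 - \<beta> / 8) * real (card ({e..<e + N} - E)) + \<tau>" using \<beta> by simp
  define e' where "e' = e + a + 1"
  show ?thesis
  proof (rule that[of e'])
    show "e + s + 1 \<le> e'" "e' < e + s + w + 1" using a by (auto simp: e'_def)
    have "{e'..<e' + N} - F \<subseteq> {e'..<e' + w} \<union> ({v0 + (a + 1)..<e + N + (a + 1)} - F)"
      using v0 by (auto simp: e'_def)
    then have "card ({e'..<e' + N} - F) \<le> card ({e'..<e' + w} \<union> ({v0 + (a + 1)..<e + N + (a + 1)} - F))"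
      by (intro card_mono) auto
    also have "\<dots> \<le> card {e'..<e' + w} + card ({v0 + (a + 1)..<e + N + (a + 1)} - F)"
      by (rule card_Un_le)
    finally show "real (card ({e'..<e' + N} - thicken (popular_sums E A \<kappa>)))
      \<le> (1 - \<beta> / 8) * real (card ({e..<e + N} - E)) + \<tau> + real w"
      using main by (simp add: F_def P_def)
    \<comment> \<open>Translation by \<open>a + 1\<close> carries surviving points to the start of
      the new window, so that the step can be repeated there.\<close>
    have "card (E1 \<inter> {e..<e + w}) \<le> card (F \<inter> {e'..<e' + w})"
    proof (rule card_inj_on_le[where f = "\<lambda>u. Suc (u + a)"])
      show "(\<lambda>u. Suc (u + a)) ` (E1 \<inter> {e..<e + w}) \<subseteq> F \<inter> {e'..<e' + w}"
        using inP by (auto simp: F_def thicken_def e'_def)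
    qed (auto simp: inj_on_def)
    then show "real (card (E \<inter> {e..<e + w})) - \<tau> \<le> real (card (thicken (popular_sums E A \<kappa>) \<inter> {e'..<e' + w}))"
      using cardE1[of "{e..<e + w}"] by (simp add: F_def P_def)
  qed
qed

section \<open>Products of primes from dyadic blocks\<close>

lemma coprime_mult_inj_on:
  fixes D M :: "nat set"
  assumes pos: "\<And>d. d \<in> D \<Longrightarrow> 0 < d" and cop: "\<And>d m. d \<in> D \<Longrightarrow> m \<in> M \<Longrightarrow> coprime d m"
  shows "inj_on (\<lambda>(d, m). d * m) (D \<times> M)"
proof (rule inj_onI, clarify)
  fix d m d' m'
  assume *: "d \<in> D" "m \<in> M" "d' \<in> D" "m' \<in> M" "d * m = d' * m'"
  have "d dvd d' * m'" using * by (metis dvd_triv_left)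
  then have "d dvd d'" using cop[OF *(1,4)] by (simp add: coprime_dvd_mult_left_iff)
  moreover have "d' dvd d * m" using * by (metis dvd_triv_left)
  then have "d' dvd d" using cop[OF *(3,2)] by (simp add: coprime_dvd_mult_left_iff)
  ultimately have "d = d'" by (rule dvd_antisym)
  then show "d = d' \<and> m = m'" using * pos[of d] by auto
qed

text \<open>\<open>R\<close> is an arbitrary set of pairs because the size condition on one factor
  depends on the other.\<close>

lemma sum_coprime_products:
  fixes g :: "nat \<Rightarrow> real"
  assumes mult: "multiplicative_fun g"
    and pos: "\<And>d. d \<in> D \<Longrightarrow> 0 < d" and cop: "\<And>d m. d \<in> D \<Longrightarrow> m \<in> M \<Longrightarrow> coprime d m"
    and R: "R \<subseteq> D \<times> M"
  shows "(\<Sum>x\<in>(\<lambda>(d, m). d * m) ` R. g x) = (\<Sum>(d, m)\<in>R. g d * g m)"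
proof -
  have "inj_on (\<lambda>(d, m). d * m) R"
    using coprime_mult_inj_on[OF pos cop] R by (rule inj_on_subset)
  then have "(\<Sum>x\<in>(\<lambda>(d, m). d * m) ` R. g x) = (\<Sum>r\<in>R. g (fst r * snd r))"
    by (subst sum.reindex) (auto simp: case_prod_beta)
  also have "\<dots> = (\<Sum>(d, m)\<in>R. g d * g m)"
    using mult cop R by (intro sum.cong) (auto simp: multiplicative_fun_def)
  finally show ?thesis .
qed

definition prime_block :: "nat \<Rightarrow> nat set" where
  "prime_block n = {p. prime p \<and> 2 ^ n < p \<and> p \<le> 2 ^ (n + 1)}"

lemma finite_prime_block [simp]: "finite (prime_block n)"
  by (rule finite_subset[of _ "{..2 ^ (n + 1)}"]) (auto simp: prime_block_def)

lemma prime_block_disjoint: "m \<noteq> n \<Longrightarrow> prime_block m \<inter> prime_block n = {}"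
proof (induction m n rule: linorder_wlog)
  case (le m n)
  then have "(2::nat) ^ (m + 1) \<le> 2 ^ n" by (intro power_increasing) auto
  then show ?case by (auto simp: prime_block_def)
qed auto

definition dyadic_sum :: "(nat \<Rightarrow> real) \<Rightarrow> nat set \<Rightarrow> nat \<Rightarrow> real" where
  "dyadic_sum g D n = (\<Sum>d | d \<in> D \<and> d \<le> 2 ^ n. g d)"

lemma dyadic_sum_mono:
  assumes "\<And>n. g n \<ge> 0" "m \<le> n"
  shows "dyadic_sum g D m \<le> dyadic_sum g D n"
  unfolding dyadic_sum_def
proof (rule sum_mono2)
  show "finite {d. d \<in> D \<and> d \<le> 2 ^ n}" by (rule finite_subset[of _ "{..2 ^ n}"]) auto
  have "(2::nat) ^ m \<le> 2 ^ n" using assms by (intro power_increasing) auto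
  then show "{d. d \<in> D \<and> d \<le> 2 ^ m} \<subseteq> {d. d \<in> D \<and> d \<le> 2 ^ n}"
    using order_trans by blast
qed (use assms in auto)

definition attach_primes :: "nat set \<Rightarrow> nat set \<Rightarrow> nat set" where
  "attach_primes D J = (\<lambda>(d, p). d * p) ` (D \<times> (\<Union>a\<in>J. prime_block a))"

text \<open>A convolution on the logarithmic scale, sorted by the block of the prime. The exponent
  rises to \<open>n + 1\<close> because block \<open>a\<close> reaches up to
  \<open>2 ^ (a + 1)\<close>.\<close>

lemma dyadic_sum_attach_primes_ge:
  fixes g :: "nat \<Rightarrow> real"
  assumes mult: "multiplicative_fun g" and nonneg: "\<And>n. g n \<ge> 0"
    and D: "finite D" and pos: "\<And>d. d \<in> D \<Longrightarrow> 0 < d"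
    and cop: "\<And>d a p. d \<in> D \<Longrightarrow> a \<in> J \<Longrightarrow> p \<in> prime_block a \<Longrightarrow> coprime d p"
    and A: "A \<subseteq> J" "finite A" "\<And>a. a \<in> A \<Longrightarrow> a \<le> n"
  shows "(\<Sum>a\<in>A. (\<Sum>p\<in>prime_block a. g p) * dyadic_sum g D (n - a)) \<le> dyadic_sum g (attach_primes D J) (n + 1)"
proof -
  define DD where "DD = (\<lambda>a. {d. d \<in> D \<and> d \<le> 2 ^ (n - a)})"
  define R where "R = (\<Union>a\<in>A. DD a \<times> prime_block a)"
  have finDD: "finite (DD a)" for a using D by (simp add: DD_def)
  have R: "R \<subseteq> D \<times> (\<Union>a\<in>J. prime_block a)" using A by (auto simp: R_def DD_def)
  have "(\<Sum>a\<in>A. (\<Sum>p\<in>prime_block a. g p) * dyadic_sum g D (n - a)) =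
      (\<Sum>a\<in>A. \<Sum>(d, p)\<in>DD a \<times> prime_block a. g d * g p)"
    unfolding dyadic_sum_def DD_def
    by (intro sum.cong refl, subst mult.commute) (simp add: sum_product sum.cartesian_product)
  also have "\<dots> = (\<Sum>(d, p)\<in>R. g d * g p)"
    unfolding R_def using A finDD prime_block_disjoint
    by (intro sum.UNION_disjoint[symmetric]) (auto simp: disjoint_iff)
  also have "\<dots> = (\<Sum>x\<in>(\<lambda>(d, m). d * m) ` R. g x)"
    using pos cop by (intro sum_coprime_products[OF mult _ _ R, symmetric]) auto
  also have "\<dots> \<le> dyadic_sum g (attach_primes D J) (n + 1)"
    unfolding dyadic_sum_def
  proof (rule sum_mono2)
    show "finite {x. x \<in> attach_primes D J \<and> x \<le> 2 ^ (n + 1)}"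
      by (rule finite_subset[of _ "{..2 ^ (n + 1)}"]) auto
    show "(\<lambda>(d, m). d * m) ` R \<subseteq> {x. x \<in> attach_primes D J \<and> x \<le> 2 ^ (n + 1)}"
    proof clarify
      fix d p assume dp: "(d, p) \<in> R"
      then obtain a where a: "a \<in> A" "d \<le> 2 ^ (n - a)" "p \<le> 2 ^ (a + 1)"
        by (auto simp: R_def DD_def prime_block_def)
      have "d * p \<le> 2 ^ (n - a) * 2 ^ (a + 1)" using a by (intro mult_mono) auto
      also have "\<dots> = 2 ^ (n + 1)" using A(3)[OF a(1)] by (simp flip: power_add)
      finally show "d * p \<in> attach_primes D J \<and> d * p \<le> 2 ^ (n + 1)"
        using dp R by (auto simp: attach_primes_def)
    qed
  qed (use nonneg in auto)
  finally show ?thesis .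
qed

text \<open>The contribution \<open>\<mu> * \<theta> * 2 ^ n\<close> does not depend on
  \<open>a\<close>, so bounding the mass from below is reduced to counting representations of
  \<open>n\<close>.\<close>

lemma dyadic_sum_attach_primes_ge_card:
  fixes g :: "nat \<Rightarrow> real"
  assumes mult: "multiplicative_fun g" and nonneg: "\<And>n. g n \<ge> 0"
    and D: "finite D" and pos: "\<And>d. d \<in> D \<Longrightarrow> 0 < d"
    and cop: "\<And>d a p. d \<in> D \<Longrightarrow> a \<in> J \<Longrightarrow> p \<in> prime_block a \<Longrightarrow> coprime d p"
    and A: "A \<subseteq> J" "finite A" "\<And>a. a \<in> A \<Longrightarrow> a \<le> n"
    and mass: "\<And>a. a \<in> A \<Longrightarrow> \<mu> * 2 ^ a \<le> (\<Sum>p\<in>prime_block a. g p)"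
    and low: "\<And>a. a \<in> A \<Longrightarrow> \<theta> * 2 ^ (n - a) \<le> dyadic_sum g D (n - a)"
    and nn: "0 \<le> \<mu>" "0 \<le> \<theta>"
  shows "real (card A) * (\<mu> * \<theta> * 2 ^ n) \<le> dyadic_sum g (attach_primes D J) (n + 1)"
proof -
  have "real (card A) * (\<mu> * \<theta> * 2 ^ n) = (\<Sum>a\<in>A. (\<mu> * 2 ^ a) * (\<theta> * 2 ^ (n - a)))"
  proof -
    have "(\<mu> * 2 ^ a) * (\<theta> * 2 ^ (n - a)) = \<mu> * \<theta> * 2 ^ n" if "a \<in> A" for a
    proof -
      have "(2::real) ^ n = 2 ^ a * 2 ^ (n - a)" using A(3)[OF that] by (simp flip: power_add)
      then show ?thesis by simp
    qed
    then have "(\<Sum>a\<in>A. (\<mu> * 2 ^ a) * (\<theta> * 2 ^ (n - a))) = (\<Sum>a\<in>A. \<mu> * \<theta> * 2 ^ n)"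
      by (intro sum.cong refl)
    then show ?thesis by simp
  qed
  also have "\<dots> \<le> (\<Sum>a\<in>A. (\<Sum>p\<in>prime_block a. g p) * dyadic_sum g D (n - a))"
    using mass low nn nonneg by (intro sum_mono mult_mono) (auto intro: sum_nonneg)
  also have "\<dots> \<le> dyadic_sum g (attach_primes D J) (n + 1)"
    by (rule dyadic_sum_attach_primes_ge) (use assms in auto)
  finally show ?thesis .
qed

lemma prime_factors_attach_primes:
  assumes D: "\<And>d p. d \<in> D \<Longrightarrow> prime p \<Longrightarrow> p dvd d \<Longrightarrow> 2 ^ l < p \<and> p \<le> 2 ^ s"
    and J: "J \<subseteq> {s..<u}" and ls: "l \<le> s"
    and x: "x \<in> attach_primes D J" "prime q" "q dvd x"
  shows "2 ^ l < q \<and> q \<le> 2 ^ u"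
proof -
  obtain d p a where d: "d \<in> D" "a \<in> J" "p \<in> prime_block a" "x = d * p"
    using x by (auto simp: attach_primes_def)
  have p: "prime p" "2 ^ a < p" "p \<le> 2 ^ (a + 1)" using d by (auto simp: prime_block_def)
  have a: "s \<le> a" "a + 1 \<le> u" using d J by auto
  have le: "(2::nat) ^ l \<le> 2 ^ a" "(2::nat) ^ (a + 1) \<le> 2 ^ u" "(2::nat) ^ s \<le> 2 ^ u"
    using a ls by (intro power_increasing; simp)+
  have "q dvd d \<or> q = p"
    using x d p by (metis prime_dvd_mult_iff primes_dvd_imp_eq)
  then show ?thesis
  proof
    assume "q dvd d"
    then show ?thesis using D[OF d(1) x(2)] le(3) by (meson order_trans)
  next
    assume "q = p"
    then show ?thesis using p le(1,2) by (meson le_less_trans order_trans)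
  qed
qed

lemma coprime_attach_primes:
  assumes D: "\<And>d p. d \<in> D \<Longrightarrow> prime p \<Longrightarrow> p dvd d \<Longrightarrow> p \<le> 2 ^ s"
    and J: "J \<subseteq> {s..}" and x: "d \<in> D" "a \<in> J" "p \<in> prime_block a"
  shows "coprime d p"
proof -
  have p: "prime p" "2 ^ a < p" using x by (auto simp: prime_block_def)
  have "(2::nat) ^ s \<le> 2 ^ a" using x J by (intro power_increasing) auto
  then have "\<not> p \<le> 2 ^ s" using p by (meson leD le_less_trans)
  then have "\<not> p dvd d" using D[of d p] x p by blast
  then show ?thesis using p by (metis coprime_commute prime_imp_coprime)
qed

lemma finite_attach_primes: "finite D \<Longrightarrow> finite J \<Longrightarrow> finite (attach_primes D J)"
  by (simp add: attach_primes_def)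

lemma attach_primes_pos:
  assumes "\<And>d. d \<in> D \<Longrightarrow> 0 < d" "x \<in> attach_primes D J"
  shows "0 < x"
  using assms by (auto simp: attach_primes_def prime_block_def prime_gt_0_nat)

text \<open>The set \<open>A\<close> collects the blocks that carry their fair share of the mass of \<open>g\<close>. The \<open>i\<close>-th prime
  of a product is taken from the blocks in \<open>[2iN, 2(i+1)N)\<close>, so that products have a unique
  representation; the sum of the left end points is \<open>(k+2)(k+3)N\<close> for \<open>k + 2\<close> primes.\<close>

locale dense_prime_blocks =
  fixes g :: "nat \<Rightarrow> real" and A :: "nat set" and N w k :: nat and \<beta> \<mu> :: real
  assumes mult: "multiplicative_fun g" and nonneg: "\<And>n. g n \<ge> 0"
    and \<beta>: "0 < \<beta>" "\<beta> \<le> 1" and w: "1 \<le> w" "w \<le> N" and \<mu>: "0 < \<mu>"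
    and dens: "\<And>s t. 2 * N \<le> s \<Longrightarrow> s + w \<le> t \<Longrightarrow> t \<le> 2 * (k + 3) * N \<Longrightarrow>
      \<beta> * (real t - real s) \<le> real (card (A \<inter> {s..<t}))"
    and mass: "\<And>a. a \<in> A \<Longrightarrow> a < 2 * (k + 3) * N \<Longrightarrow> \<mu> / N * 2 ^ a \<le> (\<Sum>p\<in>prime_block a. g p)"
begin

lemma N_pos: "0 < N" using w by simp

text \<open>The state after \<open>j + 1\<close> primes. \<open>E\<close> holds exponents at which
  the products are abundant; its window starts near the sum of the left end points and drifts by at
  most \<open>w + 1\<close> per prime. The term \<open>8 / \<beta> * (\<tau> + w)\<close> is the
  fixed point of the recursion for the complement, which multiplies by
  \<open>1 - \<beta> / 8\<close> and adds \<open>\<tau> + w\<close>. The supply of points at the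
  start of the window falls by at most \<open>\<tau>\<close> per step and so stays above
  \<open>\<tau>\<close> while \<open>j < k\<close>, as the next step demands.\<close>

lemma stages:
  fixes \<tau> \<kappa> :: real
  assumes \<tau>: "0 \<le> \<tau>" "real k * \<tau> < \<beta> * real w" and \<kappa>: "0 \<le> \<kappa>"
    and small: "24 * (\<kappa> * real N) * real N \<le> \<beta>\<^sup>2 * \<tau> * real w"
    and j: "j \<le> k"
  shows "\<exists>D E e. finite D \<and> (\<forall>d\<in>D. 0 < d) \<and>
    (\<forall>d\<in>D. \<forall>p. prime p \<longrightarrow> p dvd d \<longrightarrow> 2 ^ (2 * N) < p \<and> p \<le> 2 ^ (2 * (j + 2) * N)) \<and>
    E \<subseteq> {e..<e + N} \<and> (j + 1) * (j + 2) * N \<le> e \<and> e \<le> (j + 1) * (j + 2) * N + (j + 1) * (w + 1) \<and>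
    real (card ({e..<e + N} - E)) \<le> (1 - \<beta> / 8) ^ j * real N + 8 / \<beta> * (\<tau> + real w) \<and>
    \<beta> * real w - real j * \<tau> \<le> real (card (E \<inter> {e..<e + w})) \<and>
    (\<forall>n\<in>E. \<mu> / 2 * (\<kappa> * \<mu> / 4) ^ j / N * 2 ^ n \<le> dyadic_sum g D n)"
  using j
proof (induction j)
  case 0
  define D where "D = attach_primes {1} {2 * N..<4 * N}"
  \<comment> \<open>Block \<open>a\<close> is exhausted at exponent \<open>n = a + 1\<close>, hence
    \<open>Suc\<close>, and \<open>2 ^ a = 2 ^ n / 2\<close> is the origin of
    \<open>\<mu> / 2\<close>. The complement is bounded by the whole length \<open>N\<close> of the
    window.\<close>
  define E where "E = Suc ` (A \<inter> {2 * N..<3 * N})"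
  define e where "e = 2 * N + 1"
  have "finite D" by (simp add: D_def finite_attach_primes)
  moreover have "\<forall>d\<in>D. 0 < d" unfolding D_def using attach_primes_pos[of "{1}"] by fastforce
  moreover have "\<forall>d\<in>D. \<forall>p. prime p \<longrightarrow> p dvd d \<longrightarrow> 2 ^ (2 * N) < p \<and> p \<le> 2 ^ (4 * N)"
    using prime_factors_attach_primes[of "{1}" "2 * N" "2 * N" "{2 * N..<4 * N}" "4 * N"]
    unfolding D_def by auto
  moreover have "E \<subseteq> {e..<e + N}" by (auto simp: E_def e_def)
  moreover have "card ({e..<e + N} - E) \<le> card {e..<e + N}" by (intro card_mono) auto
  moreover have "0 \<le> 8 / \<beta> * (\<tau> + real w)" using \<beta> \<tau> by simp
  moreover have "\<beta> * real w \<le> real (card (E \<inter> {e..<e + w}))"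
  proof -
    have le: "2 * N + w \<le> 2 * (k + 3) * N" using w by (simp add: algebra_simps)
    have "\<beta> * (real (2 * N + w) - real (2 * N)) \<le> real (card (A \<inter> {2 * N..<2 * N + w}))"
      by (rule dens[OF order_refl order_refl le])
    also have "card (A \<inter> {2 * N..<2 * N + w}) \<le> card (E \<inter> {e..<e + w})"
    proof (rule card_inj_on_le[where f = Suc])
      show "Suc ` (A \<inter> {2 * N..<2 * N + w}) \<subseteq> E \<inter> {e..<e + w}"
        using w by (auto simp: E_def e_def)
    qed auto
    finally show ?thesis by simp
  qed
  moreover have "\<mu> / 2 / N * 2 ^ n \<le> dyadic_sum g D n" if "n \<in> E" for n
  proof -
    obtain a where a: "n = Suc a" "a \<in> A" "2 * N \<le> a" "a < 3 * N"
      using \<open>n \<in> E\<close> by (auto simp: E_def)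
    have "dyadic_sum g {1} 0 = 1"
      using mult by (simp add: dyadic_sum_def multiplicative_fun_def cong: conj_cong)
    moreover have "a < 2 * (k + 3) * N" using a by (simp add: algebra_simps)
    then have "\<mu> / N * 2 ^ a \<le> (\<Sum>p\<in>prime_block a. g p)" by (rule mass[OF a(2)])
    ultimately have "real (card {a}) * (\<mu> / N * 1 * 2 ^ a) \<le> dyadic_sum g D (a + 1)"
      unfolding D_def
      by (intro dyadic_sum_attach_primes_ge_card[OF mult nonneg]) (use a \<mu> in simp_all)
    then show ?thesis using a by simp
  qed
  ultimately show ?case
    by (intro exI[of _ D] exI[of _ E] exI[of _ e]) (auto simp: e_def)
next
  case (Suc j)
  define \<theta> where "\<theta> = \<mu> / 2 * (\<kappa> * \<mu> / 4) ^ j / N"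
  have \<theta>: "\<theta> \<ge> 0" using \<mu> \<kappa> by (simp add: \<theta>_def)
  from Suc obtain D E e where D: "finite D" "\<And>d. d \<in> D \<Longrightarrow> 0 < d"
    "\<And>d p. d \<in> D \<Longrightarrow> prime p \<Longrightarrow> p dvd d \<Longrightarrow> 2 ^ (2 * N) < p \<and> p \<le> 2 ^ (2 * (j + 2) * N)"
    and E: "E \<subseteq> {e..<e + N}"
    and e: "(j + 1) * (j + 2) * N \<le> e" "e \<le> (j + 1) * (j + 2) * N + (j + 1) * (w + 1)"
    and compl: "real (card ({e..<e + N} - E)) \<le> (1 - \<beta> / 8) ^ j * real N + 8 / \<beta> * (\<tau> + real w)"
    and start: "\<beta> * real w - real j * \<tau> \<le> real (card (E \<inter> {e..<e + w}))"
    and low: "\<And>n. n \<in> E \<Longrightarrow> \<theta> * 2 ^ n \<le> dyadic_sum g D n"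
    unfolding \<theta>_def by (metis Suc_leD)
  define s where "s = 2 * (j + 2) * N"
  \<comment> \<open>Length \<open>2 * N\<close> leaves room for a leader among the first
    \<open>w\<close> places followed by a window of length \<open>N\<close>.\<close>
  define J where "J = {s..<s + 2 * N}"
  define B where "B = A \<inter> J"
  define D' where "D' = attach_primes D J"
  have sk: "s + 2 * N \<le> 2 * (k + 3) * N"
  proof -
    have "s + 2 * N = 2 * (j + 3) * N" by (simp add: s_def algebra_simps)
    also have "\<dots> \<le> 2 * (k + 3) * N" using Suc.prems by (intro mult_right_mono) auto
    finally show ?thesis .
  qed
  have s2: "2 * N \<le> s" by (simp add: s_def)
  have J: "J \<subseteq> {s..<s + 2 * N}" "J \<subseteq> {s..}" by (auto simp: J_def)
  have dens_B: "\<beta> * (real t - real s) \<le> real (card (B \<inter> {s..<t}))"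
    if "s + w \<le> t" "t \<le> s + w + N" for t
  proof -
    have "B \<inter> {s..<t} = A \<inter> {s..<t}" using that w by (auto simp: B_def J_def)
    then show ?thesis using dens[of s t] that s2 sk w by simp
  qed
  have hit: "\<tau> < real (card (E \<inter> {e..<e + w}))"
  proof -
    have "real (Suc j) * \<tau> \<le> real k * \<tau>" using Suc.prems \<tau> by (intro mult_right_mono) auto
    then show ?thesis using start \<tau> by (simp add: algebra_simps)
  qed
  define P where "P = popular_sums E B (\<kappa> * real N)"
  obtain e' where e': "e + s + 1 \<le> e'" "e' < e + s + w + 1"
    "real (card ({e'..<e' + N} - thicken P)) \<le> (1 - \<beta> / 8) * real (card ({e..<e + N} - E)) + \<tau> + real w"
    "real (card (E \<inter> {e..<e + w})) - \<tau> \<le> real (card (thicken P \<inter> {e'..<e' + w}))"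
  proof (rule popular_step[of \<beta> w N "\<kappa> * real N" \<tau> E e B s])
    show "\<And>t. s + w \<le> t \<Longrightarrow> t \<le> s + w + N \<Longrightarrow> \<beta> * (real t - real s) \<le> real (card (B \<inter> {s..<t}))"
      by (rule dens_B)
  qed (use \<beta> w \<kappa> \<tau> E small hit in \<open>auto simp: B_def J_def P_def\<close>)
  define E' where "E' = thicken P \<inter> {e'..<e' + N}"
  \<comment> \<open>At least \<open>\<kappa> * N\<close> representations of weight
    \<open>\<mu> / N * \<theta> * 2 ^ n\<close> each: the factors \<open>N\<close> cancel, so no new
    \<open>1 / N\<close> appears.\<close>
  have conv: "\<kappa> * \<mu> * \<theta> * 2 ^ n \<le> dyadic_sum g D' (n + 1)" if n: "n \<in> P" for n
  proof -
    define A' where "A' = {a\<in>B. a \<le> n \<and> n - a \<in> E}"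
    have "real (card A') * (\<mu> / N * \<theta> * 2 ^ n) \<le> dyadic_sum g D' (n + 1)"
      unfolding D'_def
    proof (rule dyadic_sum_attach_primes_ge_card[OF mult nonneg D(1,2)])
      show "A' \<subseteq> J" by (auto simp: A'_def B_def)
      then show "finite A'" by (rule finite_subset) (simp add: J_def)
      show "coprime d p" if "d \<in> D" "a \<in> J" "p \<in> prime_block a" for d a p
        by (rule coprime_attach_primes[OF _ J(2) that]) (use D(3) in \<open>auto simp: s_def\<close>)
      show "\<mu> / N * 2 ^ a \<le> (\<Sum>p\<in>prime_block a. g p)" if "a \<in> A'" for a
        using that sk by (intro mass) (auto simp: A'_def B_def J_def)
      show "\<theta> * 2 ^ (n - a) \<le> dyadic_sum g D (n - a)" if "a \<in> A'" for a
        using that by (intro low) (auto simp: A'_def)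
    qed (use \<mu> \<theta> in \<open>auto simp: A'_def\<close>)
    moreover have "\<kappa> * real N * (\<mu> / N * \<theta> * 2 ^ n) \<le> real (card A') * (\<mu> / N * \<theta> * 2 ^ n)"
      using n \<mu> \<theta> by (intro mult_right_mono) (auto simp: P_def popular_sums_def A'_def)
    ultimately show ?thesis using N_pos by simp
  qed
  have low': "\<mu> / 2 * (\<kappa> * \<mu> / 4) ^ Suc j / N * 2 ^ n \<le> dyadic_sum g D' n" if "n \<in> E'" for n
  proof -
    obtain m where m: "m \<in> P" "n = m + 1 \<or> n = m + 2"
      using \<open>n \<in> E'\<close> by (auto simp: E'_def thicken_def)
    \<comment> \<open>Thickening moves \<open>m\<close> up by at most 2, which costs the factor
      4.\<close>
    have "\<mu> / 2 * (\<kappa> * \<mu> / 4) ^ Suc j / N * 2 ^ n = \<kappa> * \<mu> * \<theta> * (2 ^ n / 4)"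
      by (simp add: \<theta>_def)
    also have "\<dots> \<le> \<kappa> * \<mu> * \<theta> * 2 ^ m"
      using m \<kappa> \<mu> \<theta> by (intro mult_left_mono) auto
    also have "\<dots> \<le> dyadic_sum g D' (m + 1)" using m by (intro conv)
    also have "\<dots> \<le> dyadic_sum g D' n" using m nonneg by (intro dyadic_sum_mono) auto
    finally show ?thesis .
  qed
  have "finite D'" using D by (simp add: D'_def J_def finite_attach_primes)
  moreover have "\<forall>d\<in>D'. 0 < d" using attach_primes_pos[OF D(2)] by (simp add: D'_def)
  moreover have "\<forall>d\<in>D'. \<forall>p. prime p \<longrightarrow> p dvd d \<longrightarrow> 2 ^ (2 * N) < p \<and> p \<le> 2 ^ (2 * (Suc j + 2) * N)"
  proof -
    have "s + 2 * N = 2 * (Suc j + 2) * N" by (simp add: s_def algebra_simps)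
    then show ?thesis
      using prime_factors_attach_primes[OF D(3)[folded s_def] J(1) s2] by (auto simp: D'_def)
  qed
  moreover have "E' \<subseteq> {e'..<e' + N}" by (simp add: E'_def)
  moreover have "(Suc j + 1) * (Suc j + 2) * N = (j + 1) * (j + 2) * N + s"
    by (simp add: s_def algebra_simps)
  then have "(Suc j + 1) * (Suc j + 2) * N \<le> e'"
    "e' \<le> (Suc j + 1) * (Suc j + 2) * N + (Suc j + 1) * (w + 1)"
    using e e' by auto
  moreover have "real (card ({e'..<e' + N} - E')) \<le> (1 - \<beta> / 8) ^ Suc j * real N + 8 / \<beta> * (\<tau> + real w)"
  proof -
    have "{e'..<e' + N} - E' = {e'..<e' + N} - thicken P" by (auto simp: E'_def)
    then have "real (card ({e'..<e' + N} - E')) \<le>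
        (1 - \<beta> / 8) * real (card ({e..<e + N} - E)) + \<tau> + real w" using e' by simp
    also have "\<dots> \<le> (1 - \<beta> / 8) * ((1 - \<beta> / 8) ^ j * real N + 8 / \<beta> * (\<tau> + real w)) + \<tau> + real w"
      using compl \<beta> by (intro add_right_mono mult_left_mono) auto
    also have "\<dots> = (1 - \<beta> / 8) ^ Suc j * real N + 8 / \<beta> * (\<tau> + real w)"
      using \<beta> by (simp add: field_simps)
    finally show ?thesis .
  qed
  moreover have "\<beta> * real w - real (Suc j) * \<tau> \<le> real (card (E' \<inter> {e'..<e' + w}))"
  proof -
    have "E' \<inter> {e'..<e' + w} = thicken P \<inter> {e'..<e' + w}" using w by (auto simp: E'_def)
    then show ?thesis using e' start by (simp add: algebra_simps)
  qed
  ultimately show ?case using low'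
    by - (rule exI[of _ D'], rule exI[of _ E'], rule exI[of _ e'], intro conjI; (assumption | (rule ballI, rule low', assumption)))
qed

text \<open>Once \<open>E\<close> misses fewer than \<open>\<beta> N / 4\<close> points, one more prime reaches every point of an
  interval.\<close>

lemma products_in_every_dyadic_range:
  fixes \<tau> \<kappa> :: real
  assumes \<tau>: "0 \<le> \<tau>" "real k * \<tau> < \<beta> * real w" and \<kappa>: "0 \<le> \<kappa>"
    and small: "24 * (\<kappa> * real N) * real N \<le> \<beta>\<^sup>2 * \<tau> * real w"
    and full: "(1 - \<beta> / 8) ^ k * real N + 8 / \<beta> * (\<tau> + real w) \<le> \<beta> / 4 * real N"
    and w_small: "4 * ((k + 1) * (w + 1) + 1) \<le> N"
  obtains D where "finite D" "\<And>d. d \<in> D \<Longrightarrow> 0 < d"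
    "\<And>d p. d \<in> D \<Longrightarrow> prime p \<Longrightarrow> p dvd d \<Longrightarrow> 2 ^ (2 * N) < p"
    "\<And>n. 4 * ((k + 2) * (k + 3) * N) + 3 * N \<le> 4 * n \<Longrightarrow> n \<le> (k + 2) * (k + 3) * N + N \<Longrightarrow>
      \<beta> * \<mu> / 8 * (\<mu> / 2 * (\<kappa> * \<mu> / 4) ^ k) / N * 2 ^ n \<le> dyadic_sum g D n"
proof -
  define \<theta> where "\<theta> = \<mu> / 2 * (\<kappa> * \<mu> / 4) ^ k / N"
  have \<theta>: "\<theta> \<ge> 0" using \<mu> \<kappa> by (simp add: \<theta>_def)
  obtain D E e where D: "finite D" "\<And>d. d \<in> D \<Longrightarrow> 0 < d"
    "\<And>d p. d \<in> D \<Longrightarrow> prime p \<Longrightarrow> p dvd d \<Longrightarrow> 2 ^ (2 * N) < p \<and> p \<le> 2 ^ (2 * (k + 2) * N)"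
    and E: "E \<subseteq> {e..<e + N}"
    and e: "(k + 1) * (k + 2) * N \<le> e" "e \<le> (k + 1) * (k + 2) * N + (k + 1) * (w + 1)"
    and compl: "real (card ({e..<e + N} - E)) \<le> (1 - \<beta> / 8) ^ k * real N + 8 / \<beta> * (\<tau> + real w)"
    and low: "\<And>n. n \<in> E \<Longrightarrow> \<theta> * 2 ^ n \<le> dyadic_sum g D n"
    using stages[OF \<tau> \<kappa> small order_refl] unfolding \<theta>_def by metis
  define s where "s = 2 * (k + 2) * N"
  define J where "J = {s..<s + 2 * N}"
  define D' where "D' = attach_primes D J"
  have sk: "s + 2 * N = 2 * (k + 3) * N" by (simp add: s_def algebra_simps)
  have s2: "2 * N \<le> s" by (simp add: s_def)
  have J: "J \<subseteq> {s..<s + 2 * N}" "J \<subseteq> {s..}" by (auto simp: J_def)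
  have sum: "(k + 2) * (k + 3) * N = (k + 1) * (k + 2) * N + s"
    by (simp add: s_def algebra_simps)
  show ?thesis
  proof (rule that[of D'])
    show "finite D'" using D by (simp add: D'_def J_def finite_attach_primes)
    show "\<And>d. d \<in> D' \<Longrightarrow> 0 < d" using attach_primes_pos[OF D(2)] by (simp add: D'_def)
    show "\<And>d p. d \<in> D' \<Longrightarrow> prime p \<Longrightarrow> p dvd d \<Longrightarrow> 2 ^ (2 * N) < p"
      using prime_factors_attach_primes[OF D(3)[folded s_def] J(1) s2] by (auto simp: D'_def)
    fix n assume n: "4 * ((k + 2) * (k + 3) * N) + 3 * N \<le> 4 * n" "n \<le> (k + 2) * (k + 3) * N + N"
    \<comment> \<open>The drift of \<open>e\<close> is below \<open>N / 4\<close> by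
      \<open>w_small\<close>, so \<open>n\<close> at least \<open>3 * N / 4\<close> above the sum of
      the left end points leaves \<open>m - e - s\<close> at least \<open>N / 2\<close>. The shift
      by 1 is again due to the upper end of a prime block.\<close>
    define m where "m = n - 1"
    have m: "n = m + 1" "e + s \<le> m" "2 * (e + s) + N \<le> 2 * m" "m < e + s + N"
    proof -
      define Q W where "Q = (k + 1) * (k + 2) * N" and "W = (k + 1) * (w + 1)"
      have *: "4 * (Q + s) + 3 * N \<le> 4 * n" "n \<le> Q + s + N" "Q \<le> e" "e \<le> Q + W" "4 * (W + 1) \<le> N"
        using n e w_small unfolding sum Q_def W_def by auto
      then have "0 < n" by (cases n) auto
      then show "n = m + 1" by (simp add: m_def)
      with * show "e + s \<le> m" "2 * (e + s) + N \<le> 2 * m" "m < e + s + N" by simp_all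
    qed
    define A' where "A' = {a\<in>A \<inter> {s..<m - e + 1}. m - a \<in> E}"
    have len: "s + w \<le> m - e + 1" "m - e + 1 \<le> s + N" "real N \<le> 2 * (real (m - e + 1) - real s)"
    proof -
      have "4 * w \<le> N" using w_small by (simp add: algebra_simps)
      then show "s + w \<le> m - e + 1" using m by simp
    qed (use m in auto)
    \<comment> \<open>Pigeonhole: subtraction from \<open>m\<close> sends the failing candidates
      injectively into the complement of \<open>E\<close>. There are at least
      \<open>\<beta> * N / 2\<close> candidates and at most \<open>\<beta> * N / 4\<close> missing
      points.\<close>
    have cardA': "\<beta> / 4 * real N \<le> real (card A')"
    proof -
      have "\<beta> * (real N / 2) \<le> \<beta> * (real (m - e + 1) - real s)"
        using len \<beta> by (intro mult_left_mono) auto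
      also have "\<dots> \<le> real (card (A \<inter> {s..<m - e + 1}))"
        using len s2 sk by (intro dens) auto
      also have "card (A \<inter> {s..<m - e + 1}) \<le> card A' + card ({e..<e + N} - E)"
      proof -
        have "card (A \<inter> {s..<m - e + 1} - A') \<le> card ({e..<e + N} - E)"
        proof (rule card_inj_on_le[where f = "\<lambda>a. m - a"])
          show "inj_on (\<lambda>a. m - a) (A \<inter> {s..<m - e + 1} - A')"
            using m by (auto simp: inj_on_def)
          show "(\<lambda>a. m - a) ` (A \<inter> {s..<m - e + 1} - A') \<subseteq> {e..<e + N} - E"
            using m by (auto simp: A'_def)
        qed auto
        moreover have "A \<inter> {s..<m - e + 1} = A' \<union> (A \<inter> {s..<m - e + 1} - A')"
          by (auto simp: A'_def)
        then have "card (A \<inter> {s..<m - e + 1}) \<le> card A' + card (A \<inter> {s..<m - e + 1} - A')"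
          by (metis card_Un_le)
        ultimately show ?thesis by linarith
      qed
      finally have "\<beta> * (real N / 2) \<le> real (card A') + real (card ({e..<e + N} - E))" by simp
      moreover have "real (card ({e..<e + N} - E)) \<le> \<beta> / 4 * real N"
        using compl full by linarith
      ultimately show ?thesis by simp
    qed
    have "real (card A') * (\<mu> / N * \<theta> * 2 ^ m) \<le> dyadic_sum g D' (m + 1)"
      unfolding D'_def
    proof (rule dyadic_sum_attach_primes_ge_card[OF mult nonneg D(1,2)])
      show "A' \<subseteq> J" using len by (auto simp: A'_def J_def)
      then show "finite A'" by (rule finite_subset) (simp add: J_def)
      show "coprime d p" if "d \<in> D" "a \<in> J" "p \<in> prime_block a" for d a p
        by (rule coprime_attach_primes[OF _ J(2) that]) (use D(3) in \<open>auto simp: s_def\<close>)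
      show "\<mu> / N * 2 ^ a \<le> (\<Sum>p\<in>prime_block a. g p)" if "a \<in> A'" for a
        using that sk len by (intro mass) (auto simp: A'_def)
      show "\<theta> * 2 ^ (m - a) \<le> dyadic_sum g D (m - a)" if "a \<in> A'" for a
        using that by (intro low) (auto simp: A'_def)
    qed (use \<mu> \<theta> in \<open>auto simp: A'_def\<close>)
    moreover have "\<beta> / 4 * real N * (\<mu> / N * \<theta> * 2 ^ m) \<le> real (card A') * (\<mu> / N * \<theta> * 2 ^ m)"
      using cardA' \<mu> \<theta> by (intro mult_right_mono) auto
    moreover have "\<beta> * \<mu> / 8 * (\<mu> / 2 * (\<kappa> * \<mu> / 4) ^ k) / N * 2 ^ n = \<beta> / 4 * real N * (\<mu> / N * \<theta> * 2 ^ m)"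
      using N_pos by (simp add: \<theta>_def m(1))
    ultimately show "\<beta> * \<mu> / 8 * (\<mu> / 2 * (\<kappa> * \<mu> / 4) ^ k) / N * 2 ^ n \<le> dyadic_sum g D' n"
      using m(1) by simp
  qed
qed

end

section \<open>Sums and products over primes\<close>

lemma prod_primes_dvd:
  fixes P :: "nat set"
  assumes "finite P" "\<And>p. p \<in> P \<Longrightarrow> prime p" "\<And>p. p \<in> P \<Longrightarrow> p dvd n"
  shows "\<Prod>P dvd n"
  using assms
proof (induction P rule: finite_induct)
  case (insert p P)
  have "coprime p (\<Prod>P)"
    using insert by (intro prod_coprime_right) (auto intro!: primes_coprime)
  then show ?case using insert by (simp add: divides_mult)
qed simp

text \<open>Chebyshev's argument with \<open>m = 2 ^ n\<close>: a prime between \<open>m\<close> and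
  \<open>2 * m\<close> divides \<open>fact (2 * m)\<close> but not \<open>fact m\<close>, hence the
  central binomial coefficient.\<close>

lemma prod_prime_block_le: "\<Prod>(prime_block n) \<le> 4 ^ (2 ^ n)"
proof -
  define m :: nat where "m = 2 ^ n"
  have "\<Prod>(prime_block n) dvd (2 * m choose m)"
  proof (rule prod_primes_dvd)
    fix p assume "p \<in> prime_block n"
    then have p: "prime p" "m < p" "p \<le> 2 * m" by (auto simp: prime_block_def m_def)
    have "p dvd fact m * fact (2 * m - m) * (2 * m choose m)"
      using p by (subst binomial_fact_lemma) (auto simp: prime_dvd_fact_iff)
    moreover have "\<not> p dvd fact m" using p by (simp add: prime_dvd_fact_iff)
    ultimately show "p dvd (2 * m choose m)"
      using p by (auto simp: prime_dvd_mult_iff)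
  qed (auto simp: prime_block_def)
  then have "\<Prod>(prime_block n) \<le> (2 * m choose m)"
    by (rule dvd_imp_le) simp
  also have "\<dots> \<le> 2 ^ (2 * m)" by (rule binomial_le_pow2)
  also have "\<dots> = 4 ^ (2 ^ n)" by (simp add: power_mult m_def)
  finally show ?thesis .
qed

lemma prime_block_gt_1: "p \<in> prime_block n \<Longrightarrow> 1 < p"
  by (auto simp: prime_block_def prime_gt_1_nat)

lemma sum_ln_prime_block_le: "(\<Sum>p\<in>prime_block n. ln (real p)) \<le> 2 ^ n * ln 4"
proof -
  have pos: "0 < p" if "p \<in> prime_block n" for p using prime_block_gt_1[OF that] by simp
  have "(\<Sum>p\<in>prime_block n. ln (real p)) = ln (\<Prod>p\<in>prime_block n. real p)"
    by (rule ln_prod[symmetric]) (use pos in force)+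
  also have "(\<Prod>p\<in>prime_block n. real p) = real (\<Prod>(prime_block n))" by simp
  also have "ln \<dots> \<le> ln (real (4 ^ (2 ^ n)))"
  proof (subst ln_le_cancel_iff)
    show "0 < real (\<Prod>(prime_block n))" using pos by (auto intro!: prod_pos)
    show "real (\<Prod>(prime_block n)) \<le> real (4 ^ (2 ^ n))"
      using prod_prime_block_le by (simp only: of_nat_le_iff)
  qed simp
  also have "\<dots> = 2 ^ n * ln 4" by (simp add: ln_realpow)
  finally show ?thesis .
qed

lemma sum_ln_over_prime_block_le: "(\<Sum>p\<in>prime_block n. ln (real p) / real p) \<le> ln 4"
proof -
  have "(\<Sum>p\<in>prime_block n. ln (real p) / real p) \<le> (\<Sum>p\<in>prime_block n. ln (real p) / 2 ^ n)"
  proof (rule sum_mono)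
    fix p assume p: "p \<in> prime_block n"
    then have "2 ^ n \<le> p" by (simp add: prime_block_def)
    then have "2 ^ n \<le> real p" by (metis of_nat_le_iff of_nat_numeral of_nat_power)
    then show "ln (real p) / real p \<le> ln (real p) / 2 ^ n"
      using prime_block_gt_1[OF p] by (intro divide_left_mono) auto
  qed
  also have "\<dots> = (\<Sum>p\<in>prime_block n. ln (real p)) / 2 ^ n" by (simp add: sum_divide_distrib)
  also have "\<dots> \<le> ln 4" using sum_ln_prime_block_le[of n] by (simp add: field_simps)
  finally show ?thesis .
qed

lemma sum_inverse_prime_block_le:
  assumes "n \<ge> 1"
  shows "(\<Sum>p\<in>prime_block n. 1 / real p) \<le> 2 / real n"
proof -
  have "(\<Sum>p\<in>prime_block n. 1 / real p) \<le> (\<Sum>p\<in>prime_block n. (ln (real p) / real p) / (n * ln 2))"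
  proof (rule sum_mono)
    fix p assume p: "p \<in> prime_block n"
    then have "2 ^ n \<le> p" by (simp add: prime_block_def)
    then have "2 ^ n \<le> real p" by (metis of_nat_le_iff of_nat_numeral of_nat_power)
    then have "ln (2 ^ n) \<le> ln (real p)"
      using prime_block_gt_1[OF p] by (subst ln_le_cancel_iff) auto
    then have "n * ln 2 \<le> ln (real p)" by (simp add: ln_realpow)
    then show "1 / real p \<le> (ln (real p) / real p) / (n * ln 2)"
      using prime_block_gt_1[OF p] assms by (simp add: field_simps)
  qed
  also have "\<dots> = (\<Sum>p\<in>prime_block n. ln (real p) / real p) / (n * ln 2)"
    by (simp add: sum_divide_distrib)
  also have "\<dots> \<le> ln 4 / (n * ln 2)"
    using sum_ln_over_prime_block_le assms by (intro divide_right_mono) auto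
  also have "ln 4 = 2 * ln (2::real)" using ln_realpow[of 2 2] by simp
  finally show ?thesis by (simp add: field_simps)
qed

lemma primes_eq_UN_prime_block:
  assumes "r \<le> s"
  shows "{p. prime p \<and> 2 ^ r < p \<and> p \<le> 2 ^ s} = (\<Union>n\<in>{r..<s}. prime_block n)"
  using assms
proof (induction s rule: dec_induct)
  case base
  then show ?case by auto
next
  case (step s)
  have le: "(2::nat) ^ r \<le> 2 ^ s" using step by (intro power_increasing) auto
  have "{p. prime p \<and> 2 ^ r < p \<and> p \<le> 2 ^ Suc s} =
      {p. prime p \<and> 2 ^ r < p \<and> p \<le> 2 ^ s} \<union> prime_block s"
    by (auto simp: prime_block_def) (meson le le_less_trans)
  also have "\<dots> = (\<Union>n\<in>{r..<Suc s}. prime_block n)"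
    unfolding step.IH using step by (auto simp: less_Suc_eq)
  finally show ?case .
qed

lemma sum_primes_eq_sum_prime_block:
  assumes "r \<le> s"
  shows "(\<Sum>p | prime p \<and> 2 ^ r < p \<and> p \<le> 2 ^ s. h p) = (\<Sum>n\<in>{r..<s}. \<Sum>p\<in>prime_block n. h p)"
  unfolding primes_eq_UN_prime_block[OF assms]
  using prime_block_disjoint by (intro sum.UNION_disjoint) auto

section \<open>Truncating the expanded Euler product\<close>

text \<open>After division by the product on the right, the weights \<open>prod f Q\<close> describe
  a random subset of \<open>P\<close> that contains each \<open>p\<close> independently with
  probability \<open>f p / (1 + f p) \<le> f p\<close>. The inequality is then linearity of
  expectation for \<open>sum l Q\<close>; the induction carries this out.\<close>

lemma sum_Pow_prod_ln_le:
  fixes f :: "nat \<Rightarrow> real"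
  assumes "finite P" "\<And>p. p \<in> P \<Longrightarrow> f p \<ge> 0" "\<And>p. p \<in> P \<Longrightarrow> l p \<ge> 0"
  shows "(\<Sum>Q\<in>Pow P. prod f Q * sum l Q) \<le> (\<Sum>p\<in>P. f p * l p) * (\<Prod>p\<in>P. 1 + f p)"
  using assms
proof (induction P rule: finite_induct)
  case empty
  then show ?case by simp
next
  case (insert q P)
  define S where "S = (\<Sum>Q\<in>Pow P. prod f Q * sum l Q)"
  define T where "T = (\<Prod>p\<in>P. 1 + f p)"
  have T: "(\<Sum>Q\<in>Pow P. prod f Q) = T"
    unfolding T_def using prod_add[OF insert.hyps(1), of f "\<lambda>_. 1"] by (simp add: add.commute)
  have fq: "f q \<ge> 0" "l q \<ge> 0" using insert by auto
  have T0: "T \<ge> 0" unfolding T_def using insert by (auto intro!: prod_nonneg add_nonneg_nonneg)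
  have "(\<Sum>Q\<in>Pow (insert q P). prod f Q * sum l Q) =
      S + (\<Sum>Q\<in>Pow P. prod f (insert q Q) * sum l (insert q Q))"
  proof -
    have "inj_on (insert q) (Pow P)" using insert.hyps by (auto simp: inj_on_def)
    moreover have "Pow P \<inter> insert q ` Pow P = {}" using insert.hyps by auto
    ultimately show ?thesis
      unfolding Pow_insert S_def using insert.hyps
      by (subst sum.union_disjoint) (auto simp: sum.reindex)
  qed
  also have "(\<Sum>Q\<in>Pow P. prod f (insert q Q) * sum l (insert q Q)) =
      (\<Sum>Q\<in>Pow P. f q * l q * prod f Q + f q * (prod f Q * sum l Q))"
  proof (rule sum.cong[OF refl])
    fix Q assume "Q \<in> Pow P"
    then have "q \<notin> Q" "finite Q" using insert.hyps finite_subset by auto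
    then show "prod f (insert q Q) * sum l (insert q Q) = f q * l q * prod f Q + f q * (prod f Q * sum l Q)"
      by (simp add: algebra_simps)
  qed
  also have "\<dots> = f q * l q * T + f q * S"
    by (simp add: sum.distrib sum_distrib_left[symmetric] T S_def)
  also have "S + (f q * l q * T + f q * S) = (1 + f q) * S + f q * l q * T"
    by (simp add: algebra_simps)
  also have "\<dots> \<le> (1 + f q) * ((\<Sum>p\<in>P. f p * l p) * T) + f q * l q * ((1 + f q) * T)"
  proof (intro add_mono mult_left_mono)
    show "S \<le> (\<Sum>p\<in>P. f p * l p) * T" unfolding S_def T_def using insert by auto
    show "T \<le> (1 + f q) * T" using T0 fq by (simp add: algebra_simps)
  qed (use fq in auto)
  also have "\<dots> = (\<Sum>p\<in>insert q P. f p * l p) * (\<Prod>p\<in>insert q P. 1 + f p)"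
    using insert.hyps by (simp add: T_def algebra_simps)
  finally show ?case .
qed

lemma multiplicative_prod_primes:
  assumes mult: "multiplicative_fun g" and "finite Q" "\<And>p. p \<in> Q \<Longrightarrow> prime p"
  shows "g (\<Prod>Q) = prod g Q"
  using assms(2,3)
proof (induction Q rule: finite_induct)
  case empty
  then show ?case using mult by (simp add: multiplicative_fun_def)
next
  case (insert p Q)
  have "coprime p (\<Prod>Q)"
    using insert by (intro prod_coprime_right) (auto intro!: primes_coprime)
  then show ?case using insert mult by (simp add: multiplicative_fun_def)
qed

lemma inj_on_prod_primes: "inj_on (\<lambda>Q. \<Prod>Q) {Q. finite Q \<and> (\<forall>p\<in>Q. prime (p::nat))}"
proof (rule inj_onI)
  fix Q R :: "nat set"
  assume *: "Q \<in> {Q. finite Q \<and> (\<forall>p\<in>Q. prime p)}" "R \<in> {Q. finite Q \<and> (\<forall>p\<in>Q. prime p)}" "\<Prod>Q = \<Prod>R"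
  have key: "{p. prime p \<and> p dvd \<Prod>S} = S" if "finite S" "\<forall>p\<in>S. prime p" for S :: "nat set"
    using that by (auto simp: prime_dvd_prod_iff) (metis primes_dvd_imp_eq)
  have "Q = {p. prime p \<and> p dvd \<Prod>R}" using key[of Q] * by simp
  also have "\<dots> = R" using key[of R] * by simp
  finally show "Q = R" .
qed

text \<open>Markov's inequality for the first moment of \<open>ln m\<close> takes the place of Rankin's trick.\<close>

lemma half_prod_le_sum:
  fixes g :: "nat \<Rightarrow> real"
  assumes mult: "multiplicative_fun g" and nonneg: "\<And>n. g n \<ge> 0"
    and P: "finite P" "\<And>p. p \<in> P \<Longrightarrow> prime p"
    and Y: "1 < Y" "2 * (\<Sum>p\<in>P. g p * ln (real p) / real p) \<le> ln (real Y)"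
  shows "(\<Prod>p\<in>P. 1 + g p / real p) / 2 \<le> (\<Sum>m=1..Y. g m / real m)"
proof -
  have Y1: "ln (real Y) > 0" using Y by simp
  define f where "f = (\<lambda>p. g p / real p)"
  define T where "T = (\<Prod>p\<in>P. 1 + f p)"
  have f0: "f p \<ge> 0" for p using nonneg by (simp add: f_def)
  have T: "(\<Sum>Q\<in>Pow P. prod f Q) = T"
    unfolding T_def using prod_add[OF P(1), of f "\<lambda>_. 1"] by (simp add: add.commute)
  \<comment> \<open>Expanding the product gives one term \<open>g m / m\<close> for each squarefree
    \<open>m\<close> with prime factors in \<open>P\<close>; \<open>Small\<close> keeps those with
    \<open>m \<le> Y\<close>.\<close>
  define Small where "Small = {Q\<in>Pow P. \<Prod>Q \<le> Y}"
  have Q: "finite Q" "\<And>p. p \<in> Q \<Longrightarrow> prime p" "\<And>p. p \<in> Q \<Longrightarrow> 0 < real p" if "Q \<in> Pow P" for Q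
    using that P finite_subset prime_gt_0_nat by auto
  have "(\<Sum>Q\<in>Pow P. prod f Q) = (\<Sum>Q\<in>Pow P - Small. prod f Q) + (\<Sum>Q\<in>Small. prod f Q)"
    using P by (intro sum.subset_diff) (auto simp: Small_def)
  moreover have "(\<Sum>Q\<in>Pow P - Small. prod f Q) \<le> T / 2"
  proof -
    have "(\<Sum>Q\<in>Pow P - Small. prod f Q) * ln Y \<le> (\<Sum>Q\<in>Pow P - Small. prod f Q * (\<Sum>p\<in>Q. ln (real p)))"
      unfolding sum_distrib_right
    proof (intro sum_mono mult_left_mono)
      fix Q assume "Q \<in> Pow P - Small"
      then have "Q \<in> Pow P" and big: "Y < \<Prod>Q" by (auto simp: Small_def)
      have "real Y < real (\<Prod>Q)" using big by (simp only: of_nat_less_iff)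
      moreover have "0 < real Y" using Y by simp
      ultimately have "ln (real Y) \<le> ln (real (\<Prod>Q))"
        by (intro ln_le_cancel_iff[THEN iffD2]) linarith+
      also have "\<dots> = ln (\<Prod>p\<in>Q. real p)" by simp
      also have "\<dots> = (\<Sum>p\<in>Q. ln (real p))"
        using Q[OF \<open>Q \<in> Pow P\<close>] by (intro ln_prod) auto
      finally show "ln (real Y) \<le> (\<Sum>p\<in>Q. ln (real p))" .
    qed (use f0 in \<open>auto intro: prod_nonneg\<close>)
    also have "\<dots> \<le> (\<Sum>Q\<in>Pow P. prod f Q * (\<Sum>p\<in>Q. ln (real p)))"
      using P f0 Q
      by (intro sum_mono2 mult_nonneg_nonneg prod_nonneg sum_nonneg)
         (auto intro!: ln_ge_zero simp: Suc_leI prime_gt_0_nat)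
    also have "\<dots> \<le> (\<Sum>p\<in>P. f p * ln (real p)) * T"
      unfolding T_def using P f0 prime_gt_0_nat
      by (intro sum_Pow_prod_ln_le) (auto intro!: ln_ge_zero simp: Suc_leI)
    also have "\<dots> \<le> (ln (real Y) / 2) * T"
      using Y f0 by (intro mult_right_mono) (auto simp: f_def T_def intro!: prod_nonneg add_nonneg_nonneg)
    finally show ?thesis using Y1 by (simp add: field_simps)
  qed
  moreover have "(\<Sum>Q\<in>Small. prod f Q) \<le> (\<Sum>m=1..Y. g m / real m)"
  proof -
    have "(\<Sum>Q\<in>Small. prod f Q) = (\<Sum>Q\<in>Small. g (\<Prod>Q) / real (\<Prod>Q))"
    proof (rule sum.cong[OF refl])
      fix Q assume "Q \<in> Small"
      then have "Q \<in> Pow P" by (simp add: Small_def)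
      then show "prod f Q = g (\<Prod>Q) / real (\<Prod>Q)"
        using multiplicative_prod_primes[OF mult Q(1,2)] by (simp add: f_def prod_dividef)
    qed
    also have "\<dots> = (\<Sum>m\<in>(\<lambda>Q. \<Prod>Q) ` Small. g m / real m)"
    proof -
      have "inj_on (\<lambda>Q. \<Prod>Q) Small"
        by (rule inj_on_subset[OF inj_on_prod_primes]) (use Q in \<open>auto simp: Small_def\<close>)
      then show ?thesis by (simp add: sum.reindex)
    qed
    also have "\<dots> \<le> (\<Sum>m=1..Y. g m / real m)"
    proof (rule sum_mono2)
      have "0 < \<Prod>Q" if "Q \<in> Pow P" for Q
        using Q[OF that] by (intro prod_pos) auto
      then show "(\<lambda>Q. \<Prod>Q) ` Small \<subseteq> {1..Y}" by (force simp: Small_def Suc_le_eq)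
    qed (use nonneg in auto)
    finally show ?thesis .
  qed
  ultimately show ?thesis using T by (simp add: T_def f_def)
qed

text \<open>The reciprocals of the primes of block \<open>n\<close> add up to at most
  \<open>2 / n \<le> 2 / r\<close>. Counting \<open>s\<close> blocks is crude, but
  \<open>s / r\<close> will be bounded, so the tail costs only a constant factor.\<close>

lemma prod_tail_le:
  fixes g :: "nat \<Rightarrow> real"
  assumes nonneg: "\<And>n. g n \<ge> 0" and B: "\<And>p. prime p \<Longrightarrow> g p \<le> B" "B \<ge> 0" and r: "1 \<le> r" "r \<le> s"
  shows "(\<Prod>p | prime p \<and> 2 ^ r < p \<and> p \<le> 2 ^ s. 1 + g p / real p) \<le> exp (2 * B * real s / real r)"
proof -
  define P where "P = {p::nat. prime p \<and> 2 ^ r < p \<and> p \<le> 2 ^ s}"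
  have P: "finite P" unfolding P_def by (rule finite_subset[of _ "{..2 ^ s}"]) auto
  have "(\<Sum>p\<in>P. 1 / real p) = (\<Sum>n\<in>{r..<s}. \<Sum>p\<in>prime_block n. 1 / real p)"
    unfolding P_def using r by (intro sum_primes_eq_sum_prime_block)
  also have "\<dots> \<le> (\<Sum>n\<in>{r..<s}. 2 / real r)"
  proof (rule sum_mono)
    fix n assume n: "n \<in> {r..<s}"
    have "(\<Sum>p\<in>prime_block n. 1 / real p) \<le> 2 / real n"
      using n r by (intro sum_inverse_prime_block_le) auto
    also have "\<dots> \<le> 2 / real r" using n r by (intro divide_left_mono) auto
    finally show "(\<Sum>p\<in>prime_block n. 1 / real p) \<le> 2 / real r" .
  qed
  also have "\<dots> = real (s - r) * (2 / real r)" by simp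
  also have "\<dots> \<le> real s * (2 / real r)" by (intro mult_right_mono) auto
  finally have inv: "(\<Sum>p\<in>P. 1 / real p) \<le> real s * (2 / real r)" .
  have "(\<Sum>p\<in>P. g p / real p) \<le> (\<Sum>p\<in>P. B * (1 / real p))"
    using B by (intro sum_mono) (auto simp: P_def intro!: divide_right_mono)
  also have "\<dots> = B * (\<Sum>p\<in>P. 1 / real p)" by (simp add: sum_distrib_left)
  also have "\<dots> \<le> B * (real s * (2 / real r))" using inv B(2) by (rule mult_left_mono)
  finally have exponent: "(\<Sum>p\<in>P. g p / real p) \<le> 2 * B * real s / real r" by (simp add: mult_ac)
  have "(\<Prod>p\<in>P. 1 + g p / real p) \<le> (\<Prod>p\<in>P. exp (g p / real p))"
    using nonneg by (intro prod_mono) (auto intro!: add_nonneg_nonneg exp_ge_add_one_self)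
  also have "\<dots> = exp (\<Sum>p\<in>P. g p / real p)" using P by (simp add: exp_sum)
  also have "\<dots> \<le> exp (2 * B * real s / real r)" using exponent by simp
  finally show ?thesis by (simp add: P_def)
qed

lemma sum_weighted_prime_block_le:
  fixes g :: "nat \<Rightarrow> real"
  assumes B: "\<And>p. prime p \<Longrightarrow> g p \<le> B" "B \<ge> 0"
  shows "(\<Sum>p\<in>prime_block n. g p * ln (real p) / real p) \<le> B * ln 4"
proof -
  have "(\<Sum>p\<in>prime_block n. g p * ln (real p) / real p) \<le> (\<Sum>p\<in>prime_block n. B * (ln (real p) / real p))"
  proof (rule sum_mono)
    fix p assume p: "p \<in> prime_block n"
    then have "g p * (ln (real p) / real p) \<le> B * (ln (real p) / real p)"
      using B prime_block_gt_1[OF p] by (intro mult_right_mono) (auto simp: prime_block_def)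
    then show "g p * ln (real p) / real p \<le> B * (ln (real p) / real p)" by simp
  qed
  also have "\<dots> \<le> B * ln 4"
    unfolding sum_distrib_left[symmetric]
    using sum_ln_over_prime_block_le B(2) by (rule mult_left_mono)
  finally show ?thesis .
qed

text \<open>Markov's inequality in reverse: values below \<open>K / 2\<close> contribute at most
  half of the guaranteed sum, and the others are at most \<open>F\<close>.\<close>

lemma card_superlevel_ge:
  fixes f :: "nat \<Rightarrow> real"
  assumes F: "\<And>n. f n \<le> F" "0 < F" and K: "0 \<le> K" and st: "s \<le> t"
    and sum: "K * (real t - real s) \<le> (\<Sum>n\<in>{s..<t}. f n)"
  shows "K / (2 * F) * (real t - real s) \<le> real (card ({n. K / 2 \<le> f n} \<inter> {s..<t}))"
proof -
  define A where "A = {n. K / 2 \<le> f n}"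
  have "(\<Sum>n\<in>{s..<t}. f n) \<le> (\<Sum>n\<in>{s..<t}. (if n \<in> A then F else 0) + K / 2)"
  proof (rule sum_mono)
    fix n show "f n \<le> (if n \<in> A then F else 0) + K / 2"
      using F(1)[of n] K by (auto simp: A_def)
  qed
  also have "\<dots> = F * real (card (A \<inter> {s..<t})) + K / 2 * (real t - real s)"
    using st by (simp add: sum.distrib sum.If_cases Int_commute)
  finally have "K * (real t - real s) / 2 \<le> F * real (card (A \<inter> {s..<t}))"
    using sum by simp
  then show ?thesis using F(2) by (simp add: A_def field_simps)
qed

section \<open>The lower bound\<close>

lemma power_bracket:
  fixes b y :: real
  assumes "1 < b" "1 \<le> y"
  obtains n where "b ^ n \<le> y" "y < b ^ Suc n"
proof -
  define n where "n = (LEAST n. y < b ^ n)"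
  have n: "y < b ^ n" unfolding n_def using real_arch_pow[OF assms(1)] by (rule LeastI_ex)
  have "n \<noteq> 0" using n assms by (cases n) auto
  then obtain m where m: "n = Suc m" using not0_implies_Suc by blast
  have "\<not> y < b ^ m" using m not_less_Least[of m "\<lambda>n. y < b ^ n"] by (simp add: n_def)
  then show ?thesis using that[of m] n m by simp
qed

text \<open>Rounding \<open>x / m\<close> down to a power of 2 gives the 2 in the denominator. The
  exponent of that power is at least \<open>M * N + 3 * N / 4\<close>: locating \<open>x\<close>
  between consecutive powers of \<open>2 ^ (M + 1)\<close> costs \<open>M + 1 \<le> N / 8\<close>,
  and dividing by \<open>m \<le> 2 ^ (N div 8)\<close> another \<open>N / 8\<close>. The primes of
  \<open>d\<close> exceed \<open>2 ^ (2 * N) \<ge> m\<close>, so \<open>m * d\<close> determines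
  \<open>m\<close> and \<open>d\<close>.\<close>

lemma sum_ge_of_products:
  fixes g :: "nat \<Rightarrow> real" and x \<Theta> :: real
  assumes mult: "multiplicative_fun g" and nonneg: "\<And>n. g n \<ge> 0"
    and D: "finite D" "\<And>d. d \<in> D \<Longrightarrow> 0 < d" "\<And>d p. d \<in> D \<Longrightarrow> prime p \<Longrightarrow> p dvd d \<Longrightarrow> 2 ^ (2 * N) < p"
    and low: "\<And>n. 4 * (M * N) + 3 * N \<le> 4 * n \<Longrightarrow> n \<le> M * N + N \<Longrightarrow> \<Theta> / N * 2 ^ n \<le> dyadic_sum g D n"
    and \<Theta>: "\<Theta> \<ge> 0" and x: "2 ^ ((M + 1) * (N - 1)) \<le> x" "x < 2 ^ ((M + 1) * N)"
    and N: "8 * (M + 1) \<le> N"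
  shows "\<Theta> * x / (2 * N) * (\<Sum>m=1..2 ^ (N div 8). g m / real m) \<le> (\<Sum>n | 1 \<le> n \<and> real n \<le> x. g n)"
proof -
  define Y :: nat where "Y = 2 ^ (N div 8)"
  have x0: "0 < x" using x(1) by (meson less_le_trans zero_less_numeral zero_less_power)
  have "\<exists>n. 2 ^ n \<le> x / real m \<and> x / real m < 2 ^ Suc n \<and> 4 * (M * N) + 3 * N \<le> 4 * n \<and> n \<le> M * N + N"
    if m: "m \<in> {1..Y}" for m
  proof -
    have m0: "0 < real m" using m by simp
    have N8: "N div 8 \<le> (M + 1) * (N - 1)" using N by (cases N) auto
    have low_xm: "2 ^ ((M + 1) * (N - 1) - N div 8) \<le> x / real m"
    proof -
      have "real m \<le> 2 ^ (N div 8)" using m unfolding Y_def by (metis atLeastAtMost_iff of_nat_le_iff of_nat_numeral of_nat_power)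
      then have "2 ^ ((M + 1) * (N - 1) - N div 8) * real m \<le> 2 ^ ((M + 1) * (N - 1) - N div 8) * 2 ^ (N div 8)"
        by (intro mult_left_mono) auto
      also have "\<dots> = 2 ^ ((M + 1) * (N - 1))" using N8 by (simp flip: power_add)
      finally show ?thesis using x m0 by (simp add: field_simps)
    qed
    moreover have "(1::real) \<le> 2 ^ ((M + 1) * (N - 1) - N div 8)" by simp
    ultimately have "1 \<le> x / real m" by linarith
    then obtain n where n: "2 ^ n \<le> x / real m" "x / real m < 2 ^ Suc n"
      using power_bracket[of 2 "x / real m"] by auto
    have "(2::real) ^ ((M + 1) * (N - 1) - N div 8) < 2 ^ Suc n" using low_xm n by linarith
    then have "(M + 1) * (N - 1) - N div 8 < Suc n" by (rule power_less_imp_less_exp[rotated]) simp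
    then have "(M + 1) * (N - 1) \<le> n + N div 8" by linarith
    moreover have "(M + 1) * (N - 1) + (M + 1) = M * N + N" using N by (cases N) (auto simp: algebra_simps)
    moreover have "8 * (N div 8) \<le> N" by simp
    moreover have "4 * r + 3 * N \<le> 4 * n"
      if "q \<le> n + h" "q + (M + 1) = r + N" "8 * h \<le> N" for q r h
      using that N by simp
    ultimately have lo: "4 * (M * N) + 3 * N \<le> 4 * n" by blast
    have "x / real m \<le> x / 1" using m x0 by (intro divide_left_mono) auto
    then have "(2::real) ^ n < 2 ^ ((M + 1) * N)" using n x by linarith
    then have "n < (M + 1) * N" by (rule power_less_imp_less_exp[rotated]) simp
    then have "n \<le> M * N + N" by (simp add: algebra_simps)
    with n lo show ?thesis by blast
  qed
  then obtain e where e: "\<And>m. m \<in> {1..Y} \<Longrightarrow> 2 ^ e m \<le> x / real m"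
    "\<And>m. m \<in> {1..Y} \<Longrightarrow> x / real m < 2 ^ Suc (e m)"
    "\<And>m. m \<in> {1..Y} \<Longrightarrow> 4 * (M * N) + 3 * N \<le> 4 * e m" "\<And>m. m \<in> {1..Y} \<Longrightarrow> e m \<le> M * N + N"
    by metis
  define R where "R = (SIGMA m:{1..Y}. {d\<in>D. d \<le> 2 ^ e m})"
  have cop: "coprime m d" if "m \<in> {1..Y}" "d \<in> D" for m d
  proof (rule ccontr)
    assume "\<not> coprime m d"
    then obtain p where p: "prime p" "p dvd m" "p dvd d"
      by (metis coprime_iff_gcd_eq_1 gcd_dvd1 gcd_dvd2 dvd_trans prime_factor_nat)
    have "p \<le> m" using p that by (intro dvd_imp_le) auto
    also have "m \<le> 2 ^ (N div 8)" using that by (simp add: Y_def)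
    also have "\<dots> \<le> 2 ^ (2 * N)" by (intro power_increasing) auto
    finally show False using D(3)[OF that(2) p(1,3)] by simp
  qed
  have "\<Theta> * x / (2 * N) * (\<Sum>m=1..Y. g m / real m) = (\<Sum>m=1..Y. g m * (\<Theta> / N * (x / real m / 2)))"
    by (simp add: sum_distrib_left mult_ac)
  also have "\<dots> \<le> (\<Sum>m=1..Y. g m * dyadic_sum g D (e m))"
  proof (intro sum_mono mult_left_mono nonneg)
    fix m assume m: "m \<in> {1..Y}"
    have "x / real m / 2 \<le> 2 ^ e m" using e(2)[OF m] by simp
    then have "\<Theta> / N * (x / real m / 2) \<le> \<Theta> / N * 2 ^ e m" using \<Theta> by (intro mult_left_mono) auto
    also have "\<dots> \<le> dyadic_sum g D (e m)" using e m by (intro low) auto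
    finally show "\<Theta> / N * (x / real m / 2) \<le> dyadic_sum g D (e m)" .
  qed
  also have "\<dots> = (\<Sum>(m, d)\<in>R. g m * g d)"
    unfolding R_def dyadic_sum_def sum_distrib_left using D(1) by (subst sum.Sigma) auto
  also have "\<dots> = (\<Sum>n\<in>(\<lambda>(m, d). m * d) ` R. g n)"
    by (rule sum_coprime_products[OF mult, of "{1..Y}" D, symmetric]) (use cop in \<open>auto simp: R_def\<close>)
  also have "\<dots> \<le> (\<Sum>n | 1 \<le> n \<and> real n \<le> x. g n)"
  proof (rule sum_mono2)
    show "finite {n. 1 \<le> n \<and> real n \<le> x}"
      by (rule finite_subset[of _ "{..nat \<lfloor>x\<rfloor>}"]) (auto simp: le_nat_floor)
    show "(\<lambda>(m, d). m * d) ` R \<subseteq> {n. 1 \<le> n \<and> real n \<le> x}"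
    proof clarify
      fix m d assume "(m, d) \<in> R"
      then have m: "m \<in> {1..Y}" and d: "d \<in> D" "d \<le> 2 ^ e m" by (auto simp: R_def)
      have "real d \<le> 2 ^ e m" using d(2) by (metis of_nat_le_iff of_nat_numeral of_nat_power)
      then have "real d \<le> x / real m" using e(1)[OF m] by linarith
      then have "real (m * d) \<le> x" using m by (simp add: field_simps)
      moreover have "1 \<le> m * d" using m D(2)[OF d(1)] by (simp add: Suc_le_eq)
      ultimately show "1 \<le> m * d \<and> real (m * d) \<le> x" by blast
    qed
  qed (use nonneg in auto)
  finally show ?thesis by (simp add: Y_def)
qed

section \<open>From the liminf to the density of dyadic blocks\<close>

text \<open>Telescoping along \<open>y\<close>, \<open>b * y\<close>, \<open>b * (b * y)\<close> and
  so on, down to the last point not below \<open>s\<close>. The interval left over has length at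
  most \<open>(1 - b) * E\<close>, whence the error term.\<close>

lemma descent_lower_bound:
  fixes G :: "real \<Rightarrow> real"
  assumes mono: "mono G" and b: "0 < b" "b < 1" and K: "0 \<le> K" and y0: "0 < y0"
    and step: "\<And>y. y0 \<le> y \<Longrightarrow> K * (1 - b) * y \<le> G y - G (b * y)"
    and sy: "y0 \<le> s" "s \<le> y" "y \<le> E"
  shows "K * (y - s - (1 - b) * E) \<le> G y - G s"
proof -
  \<comment> \<open>No descent from a point at or above \<open>y0\<close> is shorter than this. As
    \<open>y\<close> is real, the induction counts multiples of \<open>\<delta>\<close>.\<close>
  define \<delta> where "\<delta> = (1 - b) * y0"
  have \<delta>: "\<delta> > 0" using b y0 by (simp add: \<delta>_def)
  have main: "K * (y - s - (1 - b) * E) \<le> G y - G s" if "s \<le> y" "y \<le> E" "y \<le> s + real k * \<delta>" for k y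
    using that
  proof (induction k arbitrary: y)
    case 0
    then have "y = s" by simp
    moreover have "0 \<le> K * ((1 - b) * E)" using K b 0 sy y0 by simp
    ultimately show ?case by simp
  next
    case (Suc k)
    have by_E: "(1 - b) * y \<le> (1 - b) * E" using b Suc.prems by (intro mult_left_mono) auto
    show ?case
    proof (cases "b * y < s")
      case True
      then have "y - s - (1 - b) * E \<le> 0" using by_E by (simp add: algebra_simps)
      then have "K * (y - s - (1 - b) * E) \<le> 0" using K by (simp add: mult_nonneg_nonpos)
      also have "0 \<le> G y - G s" using monoD[OF mono Suc.prems(1)] by simp
      finally show ?thesis .
    next
      case False
      have "(1 - b) * y0 \<le> (1 - b) * y" using b sy Suc.prems by (intro mult_left_mono) auto
      then have "b * y \<le> y - \<delta>" by (simp add: \<delta>_def algebra_simps)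
      then have "K * (b * y - s - (1 - b) * E) \<le> G (b * y) - G s"
        using False Suc.prems \<delta> by (intro Suc.IH) (auto simp: algebra_simps)
      moreover have "K * (1 - b) * y \<le> G y - G (b * y)" using sy Suc.prems by (intro step) auto
      ultimately show ?thesis by (simp add: algebra_simps)
    qed
  qed
  obtain k where "y - s \<le> real k * \<delta>"
    using ex_less_of_nat_mult[OF \<delta>, of "y - s"] by (auto intro: less_imp_le)
  then show ?thesis using main[of y k] sy by auto
qed

text \<open>With \<open>x = 2 powr y\<close> the sum in the hypothesis becomes
  \<open>G y - G (b * y)\<close>, and the descent extends the bound to arbitrary intervals of
  exponents. Because of the loss \<open>(1 - b) * t\<close> it says something only for lengths
  proportional to \<open>t\<close>. Half of \<open>c\<close> is given up to pass from the liminf to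
  all large \<open>x\<close>.\<close>

lemma prime_block_mass_density:
  fixes g :: "nat \<Rightarrow> real" and c b :: real
  assumes nonneg: "\<And>n. g n \<ge> 0" and c: "c > 0" and b: "0 < b" "b < 1"
    and hyp: "Liminf at_top (\<lambda>x::real. ereal (
          (\<Sum>p | prime p \<and> x powr b < real p \<and> real p \<le> x. g p * ln (real p) / real p)
            / ((1 - b) * ln x))) \<ge> ereal c"
  obtains t0 where "\<And>s t. t0 \<le> s \<Longrightarrow> s \<le> t \<Longrightarrow>
    c / 2 * ln 2 * (real t - real s - (1 - b) * real t) \<le> (\<Sum>n\<in>{s..<t}. \<Sum>p\<in>prime_block n. g p * ln (real p) / real p)"
proof -
  define h where "h = (\<lambda>p. g p * ln (real p) / real p)"
  define G where "G = (\<lambda>y::real. \<Sum>p | prime p \<and> real p \<le> 2 powr y. h p)"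
  have fin: "finite {p. prime p \<and> real p \<le> z}" for z
    by (rule finite_subset[of _ "{..nat \<lfloor>z\<rfloor>}"]) (auto simp: le_nat_floor)
  have h0: "0 \<le> h p" if "prime p" for p
    using nonneg prime_gt_1_nat[OF that] by (simp add: h_def)
  have diff: "G v - G u = (\<Sum>p | prime p \<and> 2 powr u < real p \<and> real p \<le> 2 powr v. h p)" if "u \<le> v" for u v
  proof -
    have uv: "2 powr u \<le> 2 powr v" using that by simp
    have "G v = (\<Sum>p\<in>{p. prime p \<and> real p \<le> 2 powr v} - {p. prime p \<and> real p \<le> 2 powr u}. h p) + G u"
      unfolding G_def using fin by (intro sum.subset_diff) (auto intro: order_trans[OF _ uv])
    moreover have "{p. prime p \<and> real p \<le> 2 powr v} - {p. prime p \<and> real p \<le> 2 powr u} =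
        {p. prime p \<and> 2 powr u < real p \<and> real p \<le> 2 powr v}" by auto
    ultimately show ?thesis by simp
  qed
  have mono: "mono G"
  proof (rule monoI)
    fix u v :: real assume "u \<le> v"
    have "0 \<le> G v - G u" unfolding diff[OF \<open>u \<le> v\<close>] using h0 by (intro sum_nonneg) auto
    then show "G u \<le> G v" by simp
  qed
  have "ereal (c / 2) < ereal c" using c by simp
  also note hyp
  finally have "eventually (\<lambda>x::real. ereal (c / 2) < ereal (
          (\<Sum>p | prime p \<and> x powr b < real p \<and> real p \<le> x. g p * ln (real p) / real p)
            / ((1 - b) * ln x))) at_top" by (rule less_LiminfD)
  then obtain X :: real where X: "\<And>x. X \<le> x \<Longrightarrow> c / 2 < (\<Sum>p | prime p \<and> x powr b < real p \<and> real p \<le> x. h p) / ((1 - b) * ln x)"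
    unfolding eventually_at_top_linorder h_def by auto
  \<comment> \<open>\<open>max 1 X\<close> keeps the logarithm meaningful, and
    \<open>1 \<le> y0\<close> makes the denominator \<open>(1 - b) * ln x\<close> positive.\<close>
  define y0 where "y0 = max 1 (log 2 (max 1 X))"
  have step: "c / 2 * ln 2 * (1 - b) * y \<le> G y - G (b * y)" if "y0 \<le> y" for y
  proof -
    have y: "1 \<le> y" "log 2 (max 1 X) \<le> y" using that by (auto simp: y0_def)
    have "X \<le> max 1 X" by simp
    also have "\<dots> = 2 powr (log 2 (max 1 X))" by simp
    also have "\<dots> \<le> 2 powr y" by (intro powr_mono y) simp
    finally have "X \<le> 2 powr y" .
    from X[OF this] have "c / 2 < (G y - G (b * y)) / ((1 - b) * (y * ln 2))"
      using diff[of "b * y" y] b y by (simp add: powr_powr mult.commute ln_powr)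
    moreover have "0 < (1 - b) * (y * ln 2)" using b y by simp
    ultimately have "c / 2 * ((1 - b) * (y * ln 2)) < G y - G (b * y)"
      by (simp add: pos_less_divide_eq)
    then show ?thesis by (simp add: mult_ac)
  qed
  show ?thesis
  proof (rule that[of "nat \<lceil>y0\<rceil>"])
    fix s t assume st: "nat \<lceil>y0\<rceil> \<le> s" "s \<le> t"
    have "c / 2 * ln 2 * (real t - real s - (1 - b) * real t) \<le> G (real t) - G (real s)"
    proof (rule descent_lower_bound[OF mono b _ _ step])
      show "0 < y0" by (simp add: y0_def)
      show "y0 \<le> real s" using st by linarith
    qed (use c st in auto)
    also have "\<dots> = (\<Sum>p | prime p \<and> 2 ^ s < p \<and> p \<le> 2 ^ t. h p)"
    proof -
      have pw: "2 powr real n = real (2 ^ n)" for n by (simp add: powr_realpow)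
      show ?thesis using st by (subst diff) (auto simp only: pw of_nat_less_iff of_nat_le_iff)
    qed
    also have "\<dots> = (\<Sum>n\<in>{s..<t}. \<Sum>p\<in>prime_block n. h p)"
      using st by (intro sum_primes_eq_sum_prime_block)
    finally show "c / 2 * ln 2 * (real t - real s - (1 - b) * real t) \<le> (\<Sum>n\<in>{s..<t}. \<Sum>p\<in>prime_block n. g p * ln (real p) / real p)"
      by (simp add: h_def)
  qed
qed

text \<open>Inside block \<open>a\<close> the weight \<open>ln p / p\<close> is at most
  \<open>C * ln 2 / 2 ^ a\<close>. Removing it costs the factor \<open>C\<close>, later a constant
  multiple of \<open>N\<close>.\<close>

lemma sum_prime_block_ge:
  fixes g :: "nat \<Rightarrow> real" and C :: nat
  assumes nonneg: "\<And>n. g n \<ge> 0"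
    and K: "K \<le> (\<Sum>p\<in>prime_block a. g p * ln (real p) / real p)" "0 \<le> K" and a: "a + 1 \<le> C"
  shows "K / (C * ln 2) * 2 ^ a \<le> (\<Sum>p\<in>prime_block a. g p)"
proof -
  have "K * (2 ^ a / (C * ln 2)) \<le> (\<Sum>p\<in>prime_block a. g p * ln (real p) / real p) * (2 ^ a / (C * ln 2))"
    using K by (intro mult_right_mono) auto
  also have "\<dots> \<le> (\<Sum>p\<in>prime_block a. g p)"
    unfolding sum_distrib_right
  proof (rule sum_mono)
    fix p assume p: "p \<in> prime_block a"
    then have "2 ^ a \<le> p" "p \<le> 2 ^ (a + 1)" by (auto simp: prime_block_def)
    then have "real (2 ^ a) \<le> real p" "real p \<le> real (2 ^ (a + 1))"
      by (simp_all only: of_nat_le_iff)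
    then have pa: "2 ^ a \<le> real p" "real p \<le> 2 ^ (a + 1)" by simp_all
    have p1: "1 < real p" using prime_block_gt_1[OF p] by simp
    have "ln (real p) \<le> ln (2 ^ (a + 1))" using pa p1 by (subst ln_le_cancel_iff) auto
    also have "\<dots> = real (a + 1) * ln 2" by (rule ln_realpow)
    also have "\<dots> \<le> real C * ln 2" using a by (intro mult_right_mono) auto
    finally have "ln (real p) / (C * ln 2) \<le> 1" using a by (simp add: field_simps)
    then have "ln (real p) / (C * ln 2) * (2 ^ a / real p) \<le> 1 * 1"
      using pa p1 by (intro mult_mono) auto
    then have "g p * (ln (real p) / (C * ln 2) * (2 ^ a / real p)) \<le> g p * 1"
      using nonneg by (intro mult_left_mono) auto
    then show "g p * ln (real p) / real p * (2 ^ a / (C * ln 2)) \<le> g p" by (simp add: mult_ac)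
  qed
  finally show ?thesis by simp
qed

lemma eventually_sum_ge:
  fixes g :: "nat \<Rightarrow> real" and c :: real
  assumes mult: "multiplicative_fun g" and nonneg: "\<And>n. g n \<ge> 0"
    and B: "\<And>p. prime p \<Longrightarrow> g p \<le> real B" "1 \<le> B" and c: "c > 0"
    and hyp: "\<And>b. 0 < b \<Longrightarrow> b < 1 \<Longrightarrow>
        Liminf at_top (\<lambda>x::real. ereal (
          (\<Sum>p | prime p \<and> x powr b < real p \<and> real p \<le> x. g p * ln (real p) / real p)
            / ((1 - b) * ln x))) \<ge> ereal c"
  obtains M N0 :: nat and \<Theta> :: real where "0 < \<Theta>" "1 \<le> M"
    "\<And>N x. N0 \<le> N \<Longrightarrow> 2 ^ ((M + 1) * (N - 1)) \<le> x \<Longrightarrow> x < 2 ^ ((M + 1) * N) \<Longrightarrow>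
      \<Theta> * x / (2 * N) * (\<Sum>m=1..2 ^ (N div 8). g m / real m) \<le> (\<Sum>n | 1 \<le> n \<and> real n \<le> x. g n)"
proof -
  define f where "f = (\<lambda>n. \<Sum>p\<in>prime_block n. g p * ln (real p) / real p)"
  define F where "F = real B * ln 4"
  define K where "K = c / 4 * ln 2"
  define \<beta> where "\<beta> = min 1 (K / (2 * F))"
  define A where "A = {n. K / 2 \<le> f n}"
  have F: "0 < F" "f n \<le> F" for n
    using B(2) sum_weighted_prime_block_le[of g "real B" n, OF B(1)] by (auto simp: F_def f_def)
  have K: "0 < K" using c by (simp add: K_def)
  have \<beta>: "0 < \<beta>" "\<beta> \<le> 1" using K F by (auto simp: \<beta>_def)
  obtain k where k: "(1 - \<beta> / 8) ^ k < \<beta> / 8"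
    using real_arch_pow_inv[of "\<beta> / 8" "1 - \<beta> / 8"] \<beta> by auto
  \<comment> \<open>Two demands on \<open>w \<le> \<epsilon> * N\<close>: the accumulated error, at
    most \<open>8 / \<beta> * (2 * w)\<close>, must not exceed \<open>\<beta> * N / 8\<close>, and
    the drift of the windows must stay below \<open>N / 4\<close>.\<close>
  define \<epsilon> where "\<epsilon> = \<beta>\<^sup>2 / (128 * (real k + 1))"
  define \<mu> where "\<mu> = K / (4 * (real k + 3) * ln 2)"
  \<comment> \<open>Makes \<open>small\<close> an equality once \<open>w\<close> is replaced by its
    lower bound \<open>\<epsilon> * N / 2\<close>.\<close>
  define \<kappa> where "\<kappa> = \<beta> ^ 3 * \<epsilon>\<^sup>2 / (96 * (real k + 1))"
  \<comment> \<open>Exponents do not exceed \<open>2 * (k + 3) * N\<close>, so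
    \<open>\<eta> * t \<le> \<epsilon> * N / 4 \<le> w / 2\<close>, at most half the length of the
    interval. This half is also why \<open>K\<close> carries \<open>c / 4\<close> instead of
    \<open>c / 2\<close>.\<close>
  define \<eta> where "\<eta> = \<epsilon> / (8 * (real k + 3))"
  define M where "M = (k + 2) * (k + 3)"
  define \<Theta> where "\<Theta> = \<beta> * \<mu> / 8 * (\<mu> / 2 * (\<kappa> * \<mu> / 4) ^ k)"
  have \<epsilon>: "0 < \<epsilon>" using \<beta> by (simp add: \<epsilon>_def)
  have \<epsilon>1: "\<epsilon> \<le> \<beta>\<^sup>2 / 128" "\<epsilon> \<le> 1 / (128 * (real k + 1))"
  proof -
    show "\<epsilon> \<le> \<beta>\<^sup>2 / 128" unfolding \<epsilon>_def by (rule divide_left_mono) auto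
    show "\<epsilon> \<le> 1 / (128 * (real k + 1))"
      unfolding \<epsilon>_def using \<beta> by (intro divide_right_mono power_le_one) auto
  qed
  have "\<epsilon> \<le> 1" using \<epsilon>1(2) by (rule order_trans) (simp add: field_simps)
  then have \<eta>: "0 < \<eta>" "\<eta> < 1" using \<epsilon> by (auto simp: \<eta>_def field_simps)
  have \<mu>: "0 < \<mu>" using K by (simp add: \<mu>_def)
  have \<kappa>: "0 < \<kappa>" using \<beta> \<epsilon> by (simp add: \<kappa>_def)
  obtain t0 where t0: "\<And>s t. t0 \<le> s \<Longrightarrow> s \<le> t \<Longrightarrow>
      c / 2 * ln 2 * (real t - real s - (1 - (1 - \<eta>)) * real t) \<le> (\<Sum>n\<in>{s..<t}. f n)"
    using prime_block_mass_density[OF nonneg c _ _ hyp[of "1 - \<eta>"]] \<eta> unfolding f_def by auto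
  \<comment> \<open>The bound \<open>2 / \<epsilon>\<close> gives
    \<open>\<epsilon> * N \<ge> 2\<close>, so that rounding down to \<open>w\<close> loses at most
    half.\<close>
  define N0 where "N0 = max (max t0 (8 * (M + 1))) (nat \<lceil>2 / \<epsilon>\<rceil>)"
  show ?thesis
  proof (rule that[of \<Theta> M N0])
    show "0 < \<Theta>" using \<beta> \<mu> \<kappa> by (simp add: \<Theta>_def)
    show "1 \<le> M" by (simp add: M_def)
    fix N and x :: real assume N: "N0 \<le> N" and x: "2 ^ ((M + 1) * (N - 1)) \<le> x" "x < 2 ^ ((M + 1) * N)"
    define w where "w = nat \<lfloor>\<epsilon> * real N\<rfloor>"
    have N': "t0 \<le> N" "8 * (M + 1) \<le> N" "2 / \<epsilon> \<le> real N"
      using N by (auto simp: N0_def nat_ceiling_le_eq)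
    have eN: "2 \<le> \<epsilon> * real N" using N'(3) \<epsilon> by (simp add: field_simps)
    have wb: "real w \<le> \<epsilon> * real N" "\<epsilon> * real N / 2 \<le> real w" "1 \<le> w"
      using eN by (auto simp: w_def) linarith+
    have wN: "w \<le> N"
    proof -
      have "\<epsilon> * real N \<le> 1 * real N" using \<open>\<epsilon> \<le> 1\<close> by (intro mult_right_mono) auto
      then show ?thesis using wb by linarith
    qed
    interpret dense_prime_blocks g A N w k \<beta> \<mu>
    proof
      fix s t assume st: "2 * N \<le> s" "s + w \<le> t" "t \<le> 2 * (k + 3) * N"
      have "real t \<le> real (2 * (k + 3) * N)" using st(3) by (simp only: of_nat_le_iff)
      then have "\<eta> * real t \<le> \<eta> * (2 * (real k + 3) * real N)"
        using \<eta> by (intro mult_left_mono) auto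
      also have "\<dots> = \<epsilon> * real N / 4" by (simp add: \<eta>_def field_simps)
      also have "\<dots> \<le> real w / 2" using wb by simp
      also have "\<dots> \<le> (real t - real s) / 2" using st by simp
      finally have gap: "(real t - real s) / 2 \<le> real t - real s - (1 - (1 - \<eta>)) * real t" by simp
      have "K * (real t - real s) = c / 2 * ln 2 * ((real t - real s) / 2)" by (simp add: K_def)
      also have "\<dots> \<le> c / 2 * ln 2 * (real t - real s - (1 - (1 - \<eta>)) * real t)"
        using gap c by (intro mult_left_mono) auto
      also have "\<dots> \<le> (\<Sum>n\<in>{s..<t}. f n)" using st N' by (intro t0) auto
      finally have "K / (2 * F) * (real t - real s) \<le> real (card (A \<inter> {s..<t}))"
        unfolding A_def using F K st by (intro card_superlevel_ge) auto
      moreover have "\<beta> * (real t - real s) \<le> K / (2 * F) * (real t - real s)"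
        using st by (intro mult_right_mono) (auto simp: \<beta>_def)
      ultimately show "\<beta> * (real t - real s) \<le> real (card (A \<inter> {s..<t}))" by linarith
    next
      fix a assume a: "a \<in> A" "a < 2 * (k + 3) * N"
      have "K / 2 / (real (2 * (k + 3) * N) * ln 2) * 2 ^ a \<le> (\<Sum>p\<in>prime_block a. g p)"
        using a K by (intro sum_prime_block_ge nonneg) (auto simp: A_def f_def)
      then show "\<mu> / N * 2 ^ a \<le> (\<Sum>p\<in>prime_block a. g p)"
        by (simp add: \<mu>_def field_simps)
    qed (use mult nonneg \<beta> wb wN \<mu> in auto)
    \<comment> \<open>With \<open>k + 1\<close> in the denominator, \<open>k\<close> steps do not
      use up the initial supply \<open>\<beta> * w\<close>.\<close>
    define \<tau> where "\<tau> = \<beta> * real w / (real k + 1)"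
    have \<tau>: "0 \<le> \<tau>" "real k * \<tau> < \<beta> * real w" "\<tau> \<le> real w"
    proof -
      have "0 < \<beta> * real w" using \<beta> wb by simp
      then show "0 \<le> \<tau>" "real k * \<tau> < \<beta> * real w" by (auto simp: \<tau>_def field_simps)
      have "\<tau> \<le> \<beta> * real w / 1"
        unfolding \<tau>_def using \<open>0 < \<beta> * real w\<close> by (intro divide_left_mono) auto
      also have "\<dots> \<le> 1 * real w / 1" using \<beta> by (intro divide_right_mono mult_right_mono) auto
      finally show "\<tau> \<le> real w" by simp
    qed
    have small: "24 * (\<kappa> * real N) * real N \<le> \<beta>\<^sup>2 * \<tau> * real w"
    proof -
      have "(\<epsilon> * real N / 2) ^ 2 \<le> real w ^ 2" using wb eN by (intro power_mono) auto
      then have "\<beta> ^ 3 / (real k + 1) * (\<epsilon> * real N / 2) ^ 2 \<le> \<beta> ^ 3 / (real k + 1) * real w ^ 2"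
        using \<beta> by (intro mult_left_mono) auto
      moreover have "24 * (\<kappa> * real N) * real N = \<beta> ^ 3 / (real k + 1) * (\<epsilon> * real N / 2) ^ 2"
        by (simp add: \<kappa>_def power2_eq_square field_simps)
      moreover have "\<beta>\<^sup>2 * \<tau> * real w = \<beta> ^ 3 / (real k + 1) * real w ^ 2"
        by (simp add: \<tau>_def power2_eq_square power3_eq_cube)
      ultimately show ?thesis by simp
    qed
    have full: "(1 - \<beta> / 8) ^ k * real N + 8 / \<beta> * (\<tau> + real w) \<le> \<beta> / 4 * real N"
    proof -
      have "(1 - \<beta> / 8) ^ k * real N \<le> \<beta> / 8 * real N" using k by (intro mult_right_mono) auto
      moreover have "8 / \<beta> * (\<tau> + real w) \<le> \<beta> / 8 * real N"
      proof -
        have "real w \<le> \<beta>\<^sup>2 / 128 * real N"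
          using wb(1) \<epsilon>1(1) mult_right_mono[of \<epsilon> "\<beta>\<^sup>2 / 128" "real N"] by simp
        then have "\<tau> + real w \<le> 2 * (\<beta>\<^sup>2 / 128 * real N)" using \<tau>(3) by linarith
        then have "8 / \<beta> * (\<tau> + real w) \<le> 8 / \<beta> * (2 * (\<beta>\<^sup>2 / 128 * real N))"
          using \<beta> by (intro mult_left_mono) auto
        also have "\<dots> = \<beta> / 8 * real N" using \<beta> by (simp add: power2_eq_square)
        finally show ?thesis .
      qed
      ultimately show ?thesis by linarith
    qed
    have w_small: "4 * ((k + 1) * (w + 1) + 1) \<le> N"
    proof -
      have "(k + 1) * (w + 1) + 1 \<le> (k + 1) * (2 * w) + (k + 1) * w"
        using wb(3) by (intro add_mono mult_left_mono) (auto intro: order_trans[OF wb(3)])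
      then have "real (4 * ((k + 1) * (w + 1) + 1)) \<le> real (12 * ((k + 1) * w))"
        by (simp only: of_nat_le_iff) simp
      also have "\<dots> = 12 * ((real k + 1) * real w)" by (simp add: algebra_simps)
      also have "\<dots> \<le> 12 * ((real k + 1) * (1 / (128 * (real k + 1)) * real N))"
        using wb(1) \<epsilon>1(2) mult_right_mono[of \<epsilon> "1 / (128 * (real k + 1))" "real N"]
        by (intro mult_left_mono) auto
      also have "\<dots> \<le> real N" by (simp add: field_simps)
      finally show ?thesis by (simp only: of_nat_le_iff)
    qed
    obtain D where D: "finite D" "\<And>d. d \<in> D \<Longrightarrow> 0 < d"
      "\<And>d p. d \<in> D \<Longrightarrow> prime p \<Longrightarrow> p dvd d \<Longrightarrow> 2 ^ (2 * N) < p"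
      "\<And>n. 4 * (M * N) + 3 * N \<le> 4 * n \<Longrightarrow> n \<le> M * N + N \<Longrightarrow> \<Theta> / N * 2 ^ n \<le> dyadic_sum g D n"
      by (rule products_in_every_dyadic_range[OF \<tau>(1,2) less_imp_le[OF \<kappa>] small full w_small, folded M_def \<Theta>_def])
        (rule that; assumption)
    show "\<Theta> * x / (2 * N) * (\<Sum>m=1..2 ^ (N div 8). g m / real m) \<le> (\<Sum>n | 1 \<le> n \<and> real n \<le> x. g n)"
      by (rule sum_ge_of_products[OF mult nonneg D _ x]) (use N' \<open>0 < \<Theta>\<close> in auto)
  qed
qed

lemma prod_primes_le_split:
  fixes g :: "nat \<Rightarrow> real" and x :: real
  assumes nonneg: "\<And>n. g n \<ge> 0" and B: "\<And>p. prime p \<Longrightarrow> g p \<le> B" "B \<ge> 0"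
    and r: "1 \<le> r" "r \<le> s" and x: "x \<le> 2 ^ s"
  shows "(\<Prod>p | prime p \<and> real p \<le> x. 1 + g p / real p) \<le>
    (\<Prod>p | prime p \<and> p \<le> 2 ^ r. 1 + g p / real p) * exp (2 * B * real s / real r)"
proof -
  have rs: "(2::nat) ^ r \<le> 2 ^ s" using r by (intro power_increasing) auto
  have ge1: "1 \<le> 1 + g p / real p" for p using nonneg by simp
  have "(\<Prod>p | prime p \<and> real p \<le> x. 1 + g p / real p) \<le> (\<Prod>p | prime p \<and> p \<le> 2 ^ s. 1 + g p / real p)"
  proof (rule prod_mono2)
    have "p \<le> 2 ^ s" if "real p \<le> x" for p
    proof -
      have "real p \<le> 2 ^ s" using that x by linarith
      then show ?thesis by (metis of_nat_le_iff of_nat_numeral of_nat_power)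
    qed
    then show "{p. prime p \<and> real p \<le> x} \<subseteq> {p. prime p \<and> p \<le> 2 ^ s}" by auto
    show "0 \<le> 1 + g p / real p" for p using ge1[of p] by linarith
  qed (use ge1 in auto)
  also have "\<dots> = (\<Prod>p\<in>{p. prime p \<and> p \<le> 2 ^ r} \<union> {p. prime p \<and> 2 ^ r < p \<and> p \<le> 2 ^ s}. 1 + g p / real p)"
    by (rule arg_cong[where f = "prod _"]) (use order_trans[OF _ rs] in auto)
  also have "\<dots> = (\<Prod>p | prime p \<and> p \<le> 2 ^ r. 1 + g p / real p) *
      (\<Prod>p | prime p \<and> 2 ^ r < p \<and> p \<le> 2 ^ s. 1 + g p / real p)"
    by (rule prod.union_disjoint) auto
  also have "\<dots> \<le> (\<Prod>p | prime p \<and> p \<le> 2 ^ r. 1 + g p / real p) * exp (2 * B * real s / real r)"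
    using nonneg B r
    by (intro mult_left_mono prod_tail_le prod_nonneg) (auto intro!: add_nonneg_nonneg)
  finally show ?thesis .
qed

theorem theorem2:
  fixes g :: "nat \<Rightarrow> real" and c :: real
  assumes mult: "multiplicative_fun g"
    and nonneg: "\<And>n. g n \<ge> 0"
    and bdd: "\<exists>B. \<forall>p. prime p \<longrightarrow> g p \<le> B"
    and c_pos: "c > 0"
    and hyp: "\<And>b. 0 < b \<Longrightarrow> b < 1 \<Longrightarrow>
        Liminf at_top (\<lambda>x::real. ereal (
          (\<Sum>p | prime p \<and> x powr b < real p \<and> real p \<le> x. g p * ln (real p) / real p)
            / ((1 - b) * ln x))) \<ge> ereal c"
  shows "\<exists>c0 > 0. \<forall>x::real. x \<ge> 2 \<longrightarrow>
      (\<Sum>n | 1 \<le> n \<and> real n \<le> x. g n) \<ge>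
        c0 * x / ln x * (\<Prod>p | prime p \<and> real p \<le> x. 1 + g p / real p)"
proof -
  obtain B0 where B0: "\<And>p. prime p \<Longrightarrow> g p \<le> B0" using bdd by blast
  define B where "B = nat \<lceil>max 1 B0\<rceil>"
  have "max 1 B0 \<le> real B" unfolding B_def by (rule real_nat_ceiling_ge)
  then have "B0 \<le> real B" and B1: "1 \<le> B" by auto
  then have B: "g p \<le> real B" if "prime p" for p using B0[OF that] by linarith
  obtain M N0 :: nat and \<Theta> :: real where \<Theta>: "0 < \<Theta>" and M: "1 \<le> M" and large:
    "\<And>N x. N0 \<le> N \<Longrightarrow> 2 ^ ((M + 1) * (N - 1)) \<le> x \<Longrightarrow> x < 2 ^ ((M + 1) * N) \<Longrightarrow>
      \<Theta> * x / (2 * N) * (\<Sum>m=1..2 ^ (N div 8). g m / real m) \<le> (\<Sum>n | 1 \<le> n \<and> real n \<le> x. g n)"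
    by (rule eventually_sum_ge[OF mult nonneg B B1 c_pos hyp]) (assumption, assumption, assumption, (rule that; assumption))
  define pr where "pr = (\<lambda>x::real. \<Prod>p | prime p \<and> real p \<le> x. 1 + g p / real p)"
  \<comment> \<open>Bounds \<open>exp (2 * B * s / r)\<close> for \<open>s = (M + 1) * N\<close> and
    \<open>N \<le> 128 * B * r\<close>.\<close>
  define C where "C = exp (256 * real B ^ 2 * real (M + 1))"
  define c1 where "c1 = \<Theta> * ln 2 / (4 * C)"
  define N1 where "N1 = max N0 (64 * B)"
  define X0 :: real where "X0 = 2 ^ ((M + 1) * N1)"
  have c1: "0 < c1" using \<Theta> by (simp add: c1_def C_def)
  have fin: "finite {p. P p \<and> real p \<le> z}" for z :: real and P :: "nat \<Rightarrow> bool"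
    by (rule finite_subset[of _ "{..nat \<lfloor>z\<rfloor>}"]) (auto simp: le_nat_floor)
  have ge1: "1 \<le> 1 + g p / real p" for p using nonneg by simp
  have pr1: "1 \<le> pr x" for x unfolding pr_def using ge1 by (intro prod_ge_1)
  have big: "c1 * x / ln x * pr x \<le> (\<Sum>n | 1 \<le> n \<and> real n \<le> x. g n)" if x: "X0 \<le> x" for x
  proof -
    have x1: "1 \<le> x" using x unfolding X0_def by (rule order_trans[rotated]) simp
    have "(1::real) < 2 ^ (M + 1)" by (intro one_less_power) auto
    then obtain n where n: "(2 ^ (M + 1)) ^ n \<le> x" "x < (2 ^ (M + 1)) ^ Suc n"
      by (rule power_bracket[OF _ x1]) (rule that; assumption)
    define N where "N = Suc n"
    have xN: "2 ^ ((M + 1) * (N - 1)) \<le> x" "x < 2 ^ ((M + 1) * N)"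
      using n unfolding N_def power_mult[symmetric] by auto
    have "(2::real) ^ ((M + 1) * N1) < 2 ^ ((M + 1) * N)" using x xN unfolding X0_def by linarith
    then have "(M + 1) * N1 < (M + 1) * N" by (rule power_less_imp_less_exp[rotated]) simp
    then have "N1 < N" by (simp only: mult_less_cancel1)
    then have N: "N0 \<le> N" "64 * B \<le> N" by (auto simp: N1_def)
    then have "2 \<le> N" using B1 by simp
    \<comment> \<open>The first-moment condition with \<open>Y = 2 ^ (N div 8)\<close> asks for
      \<open>32 * B * r \<le> N\<close>. As \<open>r\<close> is also at least a constant times
      \<open>N\<close>, the primes between \<open>2 ^ r\<close> and \<open>x\<close> contribute at
      most the factor \<open>C\<close>.\<close>
    define r where "r = N div (64 * B)"
    define s where "s = (M + 1) * N"
    have r1: "1 \<le> r" using N B1 by (simp add: r_def Suc_le_eq div_greater_zero_iff)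
    have r_le: "64 * B * r \<le> N" by (simp add: r_def)
    have r_ge: "N \<le> 128 * B * r"
    proof -
      have "N = 64 * B * r + N mod (64 * B)" by (simp add: r_def)
      moreover have "N mod (64 * B) < 64 * B" using B1 by simp
      moreover have "64 * B * 1 \<le> 64 * B * r" using r1 by (intro mult_left_mono) auto
      ultimately show ?thesis by linarith
    qed
    have "r \<le> N" unfolding r_def by (rule div_le_dividend)
    also have "\<dots> \<le> s" by (simp add: s_def)
    finally have rs: "r \<le> s" .
    define P where "P = {p::nat. prime p \<and> p \<le> 2 ^ r}"
    have half: "(\<Prod>p\<in>P. 1 + g p / real p) / 2 \<le> (\<Sum>m=1..2 ^ (N div 8). g m / real m)"
    proof (rule half_prod_le_sum[OF mult nonneg])
      have "(\<Sum>p\<in>P. g p * ln (real p) / real p) =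
          (\<Sum>p | prime p \<and> 2 ^ 0 < p \<and> p \<le> 2 ^ r. g p * ln (real p) / real p)"
        unfolding P_def by (intro sum.cong) (auto simp: prime_gt_Suc_0_nat)
      also have "\<dots> = (\<Sum>n\<in>{0..<r}. \<Sum>p\<in>prime_block n. g p * ln (real p) / real p)"
        by (rule sum_primes_eq_sum_prime_block) simp
      also have "\<dots> \<le> (\<Sum>n\<in>{0..<r}. real B * ln 4)"
        using B by (intro sum_mono sum_weighted_prime_block_le) auto
      also have "\<dots> = 2 * real B * real r * ln 2" using ln_realpow[of 2 2] by simp
      finally have "2 * (\<Sum>p\<in>P. g p * ln (real p) / real p) \<le> real (4 * B * r) * ln 2" by simp
      also have "\<dots> \<le> real (N div 8) * ln 2"
      proof (intro mult_right_mono of_nat_mono)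
        have "4 * B * r * 8 \<le> N" using r_le by simp
        then show "4 * B * r \<le> N div 8" by (simp add: less_eq_div_iff_mult_less_eq)
      qed simp
      also have "\<dots> = ln (real (2 ^ (N div 8)))" by (simp add: ln_realpow)
      finally show "2 * (\<Sum>p\<in>P. g p * ln (real p) / real p) \<le> ln (real (2 ^ (N div 8)))" .
      have "N div 8 \<noteq> 0" using N B1 by simp
      then show "1 < (2::nat) ^ (N div 8)" by (intro one_less_power) auto
    qed (auto simp: P_def)
    have tail: "pr x \<le> (\<Prod>p\<in>P. 1 + g p / real p) * C"
    proof -
      have "pr x \<le> (\<Prod>p\<in>P. 1 + g p / real p) * exp (2 * real B * real s / real r)"
        unfolding pr_def P_def
        using nonneg B r1 rs xN(2) by (intro prod_primes_le_split) (auto simp: s_def)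
      also have "\<dots> \<le> (\<Prod>p\<in>P. 1 + g p / real p) * C"
      proof (intro mult_left_mono)
        have "real N \<le> real (128 * B * r)" using r_ge by (simp only: of_nat_le_iff)
        then have "2 * real B * real (M + 1) * real N \<le> 2 * real B * real (M + 1) * real (128 * B * r)"
          by (intro mult_left_mono) auto
        then have "2 * real B * real s \<le> 256 * real B ^ 2 * real (M + 1) * real r"
          by (simp add: s_def power2_eq_square algebra_simps)
        then show "exp (2 * real B * real s / real r) \<le> C"
          using r1 by (simp add: C_def pos_divide_le_eq)
        have "0 \<le> 1 + g p / real p" for p using ge1[of p] by linarith
        then show "0 \<le> (\<Prod>p\<in>P. 1 + g p / real p)" by (intro prod_nonneg) auto
      qed
      finally show ?thesis .
    qed
    have "0 < C" by (simp add: C_def)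
    then have "pr x / (2 * C) \<le> (\<Prod>p\<in>P. 1 + g p / real p) / 2"
      using tail by (simp add: field_simps)
    also note half
    finally have lower: "pr x / (2 * C) \<le> (\<Sum>m=1..2 ^ (N div 8). g m / real m)" .
    \<comment> \<open>Trades the factor \<open>1 / N\<close> for \<open>1 / ln x\<close>.\<close>
    have N_ln: "real N * ln 2 \<le> ln x"
    proof -
      have "N \<le> 2 * (N - 1)" using \<open>2 \<le> N\<close> by simp
      also have "\<dots> \<le> (M + 1) * (N - 1)" using M by (intro mult_right_mono) auto
      finally have "real N * ln 2 \<le> real ((M + 1) * (N - 1)) * ln 2"
        by (intro mult_right_mono of_nat_mono) auto
      also have "\<dots> = ln (2 ^ ((M + 1) * (N - 1)))" by (rule ln_realpow[symmetric])
      also have "\<dots> \<le> ln x" using xN(1) x1 by (subst ln_le_cancel_iff) auto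
      finally show ?thesis .
    qed
    have N0': "0 < real N" using \<open>2 \<le> N\<close> by simp
    have lnx: "0 < ln x" using N_ln N0' by (smt (verit) ln_gt_zero mult_pos_pos)
    have "c1 * x / ln x * pr x = \<Theta> * x * (ln 2 / ln x) / 2 * (pr x / (2 * C))"
      by (simp add: c1_def mult_ac)
    also have "\<dots> \<le> \<Theta> * x * (1 / N) / 2 * (pr x / (2 * C))"
    proof -
      have "ln 2 / ln x \<le> 1 / N" using N_ln lnx N0' by (simp add: field_simps)
      then show ?thesis using \<Theta> x1 pr1[of x] \<open>0 < C\<close>
        by (intro mult_right_mono divide_right_mono mult_left_mono) auto
    qed
    also have "\<dots> = \<Theta> * x / (2 * N) * (pr x / (2 * C))" by simp
    also have "\<dots> \<le> \<Theta> * x / (2 * N) * (\<Sum>m=1..2 ^ (N div 8). g m / real m)"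
      using lower \<Theta> x1 by (intro mult_left_mono) auto
    also have "\<dots> \<le> (\<Sum>n | 1 \<le> n \<and> real n \<le> x. g n)"
      by (rule large[OF N(1) xN])
    finally show ?thesis .
  qed
  \<comment> \<open>For \<open>x < X0\<close> the single term \<open>g 1 = 1\<close> suffices:
    \<open>x * pr x \<le> X0 * pr X0\<close> and \<open>ln 2 \<le> ln x\<close>, so the second entry
    makes the claimed bound at most 1.\<close>
  define c0 where "c0 = min c1 (ln 2 / (X0 * pr X0))"
  have X0: "0 < X0" by (simp add: X0_def)
  have pr0: "0 < pr x" for x using pr1[of x] by linarith
  have c0: "0 < c0" using c1 X0 pr0 by (simp add: c0_def)
  have "c0 * x / ln x * pr x \<le> (\<Sum>n | 1 \<le> n \<and> real n \<le> x. g n)" if x: "2 \<le> x" for x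
  proof (cases "X0 \<le> x")
    case True
    have "c0 * (x / ln x * pr x) \<le> c1 * (x / ln x * pr x)"
      using x pr0[of x] by (intro mult_right_mono) (auto simp: c0_def)
    then show ?thesis using big[OF True] by simp
  next
    case False
    have "pr x \<le> pr X0"
      unfolding pr_def
    proof (rule prod_mono2)
      show "0 \<le> 1 + g p / real p" for p using ge1[of p] by linarith
    qed (use False fin ge1 in auto)
    then have "x * pr x \<le> X0 * pr X0" using False x pr0[of x] X0 by (intro mult_mono) auto
    moreover have "c0 * (x * pr x) \<le> ln 2 / (X0 * pr X0) * (x * pr x)"
      using x pr0[of x] by (intro mult_right_mono) (auto simp: c0_def)
    ultimately have "c0 * (x * pr x) \<le> ln 2"
      using X0 pr0[of X0] by (smt (verit) divide_pos_pos ln_gt_zero mult_left_mono mult_pos_pos nonzero_eq_divide_eq)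
    also have "\<dots> \<le> ln x" using x by simp
    finally have "c0 * x / ln x * pr x \<le> 1" using x by (simp add: field_simps)
    also have "1 = (\<Sum>n\<in>{1}. g n)" using mult by (simp add: multiplicative_fun_def)
    also have "\<dots> \<le> (\<Sum>n | 1 \<le> n \<and> real n \<le> x. g n)"
      using x nonneg fin by (intro sum_mono2) auto
    finally show ?thesis .
  qed
  then show ?thesis using c0 unfolding pr_def by blast
qed

end
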